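(* Let $\varepsilon \le 1$ and $\delta \in O(1/\sqrt{n})$, and let $\mathcal{M}$ be an $(\varepsilon,\delta)$-differentially private minimum spanning tree algorithm. There exists an input graph $G = (V, E, \vec{W})$ with $n$ vertices such that, if $T^*$ is the minimum spanning tree of $G$, the (random) spanning tree $\mathcal{M}(G)$ released by $\mathcal{M}$ satisfies $$\mathbb{E}_{\mathcal{M}}\left[\sum_{e \in \mathcal{M}(G)} w_e\right] - \sum_{e \in T^*} w_e \in \Omega\left(\frac{1}{\varepsilon} \cdot n^{3/2} \cdot \ln n\right).$$
   Context: A graph $G = (V, E, \vec{W})$ has public vertex set $V = \{1,\dots,n\}$, public undirected edge set $E$, and private weight vector $\vec{W} = (w_e)_{e\in E} \in \mathbb{R}^{E}$. A minimum spanning tree $T^*$ is a spanning tree minimizing $\sum_{e\in T^*} w_e$. Two graphs $G=(V,E,\vec{W})$ and $G'=(V',E',\vec{W}')$ are neighboring if $V=V'$, $E=E'$ and $\max_{e\in E}|w_e - w'_e| \le 1$. A randomized algorithm $\mathcal{M}$ that outputs a spanning tree of its input graph is an $(\varepsilon,\delta)$-differentially private MST algorithm if for all neighboring $G, G'$ and every set $Z$ of spanning trees, $\Pr[\mathcal{M}(G)\in Z] \le e^{\varepsilon}\Pr[\mathcal{M}(G')\in Z] + \delta$. *)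

theory Defs
  imports "HOL-Probability.Probability" "HOL-Library.Landau_Symbols"
begin

text \<open>
  Undirected edges are two-element vertex sets. The weight vector of \<open>\<real>\<^sup>E\<close> is a function that is
  extensional on \<open>E\<close>, so an algorithm sees nothing beyond the weights of the edges of its input.
\<close>

record wgraph =
  nverts :: nat
  edges :: "nat set set"
  weight :: "nat set \<Rightarrow> real"

definition verts :: "wgraph \<Rightarrow> nat set" where
  "verts G = {1..nverts G}"

definition wf_graph :: "wgraph \<Rightarrow> bool" where
  "wf_graph G \<longleftrightarrow> edges G \<subseteq> {e. e \<subseteq> verts G \<and> card e = 2} \<and> weight G \<in> extensional (edges G)"

definition adj :: "nat set set \<Rightarrow> (nat \<times> nat) set" where
  "adj F = {(u, v). {u, v} \<in> F}"

definition connected_edges :: "nat set \<Rightarrow> nat set set \<Rightarrow> bool" where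
  "connected_edges V F \<longleftrightarrow> (\<forall>u\<in>V. \<forall>v\<in>V. (u, v) \<in> (adj F)\<^sup>*)"

definition is_cycle :: "nat set set \<Rightarrow> nat list \<Rightarrow> bool" where
  "is_cycle F vs \<longleftrightarrow> 3 \<le> length vs \<and> distinct vs \<and>
     (\<forall>i<length vs. {vs ! i, vs ! (Suc i mod length vs)} \<in> F)"

definition acyclic_edges :: "nat set set \<Rightarrow> bool" where
  "acyclic_edges F \<longleftrightarrow> \<not> (\<exists>vs. is_cycle F vs)"

definition spanning_tree :: "wgraph \<Rightarrow> nat set set \<Rightarrow> bool" where
  "spanning_tree G T \<longleftrightarrow> T \<subseteq> edges G \<and> connected_edges (verts G) T \<and> acyclic_edges T"

definition tree_weight :: "wgraph \<Rightarrow> nat set set \<Rightarrow> real" where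
  "tree_weight G T = (\<Sum>e\<in>T. weight G e)"

definition minimum_spanning_tree :: "wgraph \<Rightarrow> nat set set \<Rightarrow> bool" where
  "minimum_spanning_tree G T \<longleftrightarrow>
     spanning_tree G T \<and> (\<forall>T'. spanning_tree G T' \<longrightarrow> tree_weight G T \<le> tree_weight G T')"

text \<open>Only connected graphs have a spanning tree that an algorithm could release.\<close>

definition input_graph :: "wgraph \<Rightarrow> bool" where
  "input_graph G \<longleftrightarrow> wf_graph G \<and> connected_edges (verts G) (edges G)"

definition neighboring :: "wgraph \<Rightarrow> wgraph \<Rightarrow> bool" where
  "neighboring G G' \<longleftrightarrow> nverts G = nverts G' \<and> edges G = edges G' \<and>
     (\<forall>e\<in>edges G. \<bar>weight G e - weight G' e\<bar> \<le> 1)"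

text \<open>
  A graph has finitely many spanning trees, so a \<open>pmf\<close> describes any output distribution.
  The parameter \<open>\<delta>\<close> may depend on the number of vertices, which neighbouring graphs share.
\<close>

definition dp_mst_algorithm ::
    "real \<Rightarrow> (nat \<Rightarrow> real) \<Rightarrow> (wgraph \<Rightarrow> nat set set pmf) \<Rightarrow> bool" where
  "dp_mst_algorithm \<epsilon> \<delta> M \<longleftrightarrow>
     (\<forall>G. input_graph G \<longrightarrow> set_pmf (M G) \<subseteq> {T. spanning_tree G T}) \<and>
     (\<forall>G G' Z. input_graph G \<and> input_graph G' \<and> neighboring G G' \<and> Z \<subseteq> {T. spanning_tree G T} \<longrightarrow>
        measure_pmf.prob (M G) Z \<le> exp \<epsilon> * measure_pmf.prob (M G') Z + \<delta> (nverts G))"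

end

theory Submission
  imports Defs
begin

text \<open>
  Each of about \<open>n / 2\<close> leaves may be attached to any of \<open>d = n div 2\<close> hubs, and attaching along an edge
  \<open>e\<close> costs \<open>L - g e\<close> with \<open>g e \<in> {0..L}\<close>. The \<open>g e\<close> are drawn independently from a law with an
  atom of mass 1/2 at 0 and a truncated geometric tail on \<open>{1..L}\<close> of ratio
  \<open>1 - 2 * a\<close>, where \<open>a = \<epsilon> / sqrt k\<close> and \<open>k = n - d\<close>. This law is the stationary law of a reversible walk with steps of size at most 1 and
  drift exactly \<open>- a\<close> away from 0 and \<open>+ a\<close> at 0. Let \<open>g'\<close> arise from \<open>g\<close> by one step of
  the walk in each coordinate and let \<open>f\<close> be the sum of \<open>g' - g\<close> over the \<open>k\<close> chosen leaf edges. By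
  reversibility, \<open>f\<close> computed for the output on \<open>g'\<close> is distributed as \<open>- f\<close> for the output on \<open>g\<close>.
  Privacy makes the two means differ by at most about \<open>\<epsilon> * sqrt k\<close>, since \<open>f\<close> has second moment
  at most \<open>2 * k\<close>; this second moment also absorbs every \<open>\<delta>\<close> tending to 0. Hence the mean of
  \<open>f\<close> cannot be close to \<open>- a * k\<close>: a constant fraction of the chosen edges has \<open>g e = 0\<close>. As nearly
  every leaf has an edge with \<open>g e = L\<close> as long as \<open>L\<close> is a small multiple of \<open>ln n / a\<close>, each such
  choice wastes \<open>L\<close>.
\<close>

subsection \<open>Moments under product weights\<close>

text \<open>Absorb \<open>\<phi>\<close> into the factor at \<open>e1\<close>, then exchange sum and
  product. Writing the mean as \<open>W e1 * c1\<close> instead of a quotient keeps states of mass 0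
  admissible.\<close>

lemma sum_PiE_moment1:
  fixes q :: "'a \<Rightarrow> 'b \<Rightarrow> real"
  assumes "finite A" "finite S" "e1 \<in> A"
    and W: "\<And>e. e \<in> A \<Longrightarrow> (\<Sum>s\<in>S. q e s) = W e"
    and c1: "(\<Sum>s\<in>S. q e1 s * \<phi> s) = W e1 * c1"
  shows "(\<Sum>g\<in>A \<rightarrow>\<^sub>E S. (\<Prod>e\<in>A. q e (g e)) * \<phi> (g e1)) = (\<Prod>e\<in>A. W e) * c1"
proof -
  define F where "F e s = q e s * (if e = e1 then \<phi> s else 1)" for e s
  have "(\<Prod>e\<in>A. q e (g e)) * \<phi> (g e1) = (\<Prod>e\<in>A. F e (g e))" for g
    using assms(1,3) by (simp add: F_def prod.distrib)
  then have "(\<Sum>g\<in>A \<rightarrow>\<^sub>E S. (\<Prod>e\<in>A. q e (g e)) * \<phi> (g e1)) = (\<Prod>e\<in>A. \<Sum>s\<in>S. F e s)"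
    using assms(1,2) by (simp add: prod_sum_PiE)
  also have "\<dots> = (\<Prod>e\<in>A. W e * (if e = e1 then c1 else 1))"
    by (intro prod.cong) (auto simp: F_def W c1)
  also have "\<dots> = (\<Prod>e\<in>A. W e) * c1"
    using assms(1,3) by (simp add: prod.distrib)
  finally show ?thesis .
qed

lemma sum_PiE_moment2:
  fixes q :: "'a \<Rightarrow> 'b \<Rightarrow> real"
  assumes "finite A" "finite S" "e1 \<in> A" "e2 \<in> A" "e1 \<noteq> e2"
    and W: "\<And>e. e \<in> A \<Longrightarrow> (\<Sum>s\<in>S. q e s) = W e"
    and c1: "(\<Sum>s\<in>S. q e1 s * \<phi> s) = W e1 * c1"
    and c2: "(\<Sum>s\<in>S. q e2 s * \<psi> s) = W e2 * c2"
  shows "(\<Sum>g\<in>A \<rightarrow>\<^sub>E S. (\<Prod>e\<in>A. q e (g e)) * (\<phi> (g e1) * \<psi> (g e2))) = (\<Prod>e\<in>A. W e) * (c1 * c2)"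
proof -
  define F where "F e s = q e s * ((if e = e1 then \<phi> s else 1) * (if e = e2 then \<psi> s else 1))" for e s
  have "(\<Prod>e\<in>A. q e (g e)) * (\<phi> (g e1) * \<psi> (g e2)) = (\<Prod>e\<in>A. F e (g e))" for g
    using assms(1,3,4) by (simp add: F_def prod.distrib)
  then have "(\<Sum>g\<in>A \<rightarrow>\<^sub>E S. (\<Prod>e\<in>A. q e (g e)) * (\<phi> (g e1) * \<psi> (g e2))) = (\<Prod>e\<in>A. \<Sum>s\<in>S. F e s)"
    using assms(1,2) by (simp add: prod_sum_PiE)
  also have "\<dots> = (\<Prod>e\<in>A. W e * ((if e = e1 then c1 else 1) * (if e = e2 then c2 else 1)))"
    using assms(5) by (intro prod.cong) (auto simp: F_def W c1 c2)
  also have "\<dots> = (\<Prod>e\<in>A. W e) * (c1 * c2)"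
    using assms(1,3,4) by (simp add: prod.distrib)
  finally show ?thesis .
qed

subsection \<open>Expectations under differential privacy\<close>

text \<open>This is tanh (x / 2) \<le> x / 2 with the denominator cleared. The difference
  \<open>h\<close> of the two sides vanishes at 0 and has derivative
  \<open>(1 - exp y * (1 - y)) / 2\<close>, which is nonnegative.\<close>

lemma exp_minus_one_le:
  fixes x :: real
  assumes "0 \<le> x"
  shows "exp x - 1 \<le> x / 2 * (exp x + 1)"
proof -
  define h where "h y = y / 2 * (exp y + 1) - exp y + 1" for y :: real
  have "h 0 \<le> h x"
  proof (rule DERIV_nonneg_imp_nondecreasing[OF assms])
    fix y :: real assume y: "0 \<le> y"
    have "(h has_real_derivative (1 - exp y * (1 - y)) / 2) (at y)"
      unfolding h_def by (auto intro!: derivative_eq_intros simp: field_simps)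
    moreover have "exp y * (1 - y) \<le> 1"
    proof -
      have "1 - y \<le> exp (- y)" using exp_ge_add_one_self[of "- y"] by simp
      then have "exp y * (1 - y) \<le> exp y * exp (- y)" by (intro mult_left_mono) auto
      then show ?thesis by (simp flip: exp_add)
    qed
    ultimately show "\<exists>D. (h has_real_derivative D) (at y) \<and> 0 \<le> D" by fastforce
  qed
  then show ?thesis by (simp add: h_def)
qed

text \<open>While \<open>q \<le> exp x * p\<close>, the ratio of \<open>q - p\<close> to
  \<open>p + q\<close> is at most tanh (x / 2), hence at most \<open>x / 2\<close>. Whatever
  \<open>q\<close> has beyond \<open>exp x * p\<close> is paid for by the last term.\<close>

lemma excess_bound:
  fixes x p q :: real
  assumes "0 \<le> x" "0 \<le> p" "0 \<le> q"
  shows "q - p \<le> x / 2 * (p + q) + max 0 (q - exp x * p)"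
proof -
  have key: "q - p \<le> x / 2 * (p + q)" if "q \<le> exp x * p" "0 \<le> q" for q
  proof (cases "x \<ge> 2")
    \<comment> \<open>Here \<open>q - p \<le> p + q\<close> is enough. In the other case
      \<open>1 - x / 2\<close> is positive and may multiply the hypothesis on
      \<open>q\<close>.\<close>
    case True
    have "q - p \<le> 1 * (p + q)" using assms by simp
    also have "\<dots> \<le> x / 2 * (p + q)"
      using True assms that by (intro mult_right_mono) auto
    finally show ?thesis .
  next
    case False
    have "(1 - x / 2) * q \<le> (1 - x / 2) * (exp x * p)"
      using False that by (intro mult_left_mono) auto
    also have "\<dots> \<le> (1 + x / 2) * p"
    proof -
      have "p * ((1 - x / 2) * exp x) \<le> p * (1 + x / 2)"
        using exp_minus_one_le[OF assms(1)] assms(2)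
        by (intro mult_left_mono) (auto simp: field_simps)
      then show ?thesis by (simp add: mult_ac)
    qed
    finally show ?thesis by (simp add: field_simps)
  qed
  show ?thesis
  proof (cases "q \<le> exp x * p")
    case True
    then show ?thesis using key[OF True assms(3)] by simp
  next
    case False
    have "exp x * p - p \<le> x / 2 * (p + exp x * p)"
      using assms by (intro key) auto
    also have "\<dots> \<le> x / 2 * (p + q)"
      using False assms by (intro mult_left_mono) auto
    finally show ?thesis using False by simp
  qed
qed

text \<open>The sum is the hockey-stick divergence. The event \<open>Z\<close> of all outcomes with
  nonnegative excess attains it, so privacy for this single event bounds it.\<close>

lemma excess_sum_le:
  fixes p q :: "'c pmf"
  assumes "finite Y" "0 \<le> \<epsilon>"
    and dp: "\<And>Z. Z \<subseteq> Y \<Longrightarrow> measure_pmf.prob q Z \<le> exp \<epsilon> * measure_pmf.prob p Z + \<delta>"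
  shows "(\<Sum>y\<in>Y. max 0 (pmf q y - exp \<epsilon> * pmf p y)) \<le> \<delta>"
proof -
  define Z where "Z = {y\<in>Y. exp \<epsilon> * pmf p y \<le> pmf q y}"
  have Z: "Z \<subseteq> Y" "finite Z" using assms(1) by (auto simp: Z_def)
  have "(\<Sum>y\<in>Y. max 0 (pmf q y - exp \<epsilon> * pmf p y)) = (\<Sum>y\<in>Z. max 0 (pmf q y - exp \<epsilon> * pmf p y))"
    using Z assms(1) by (intro sum.mono_neutral_right) (auto simp: Z_def)
  also have "\<dots> = (\<Sum>y\<in>Z. pmf q y - exp \<epsilon> * pmf p y)"
    by (intro sum.cong) (auto simp: Z_def)
  also have "\<dots> = measure_pmf.prob q Z - exp \<epsilon> * measure_pmf.prob p Z"
    using Z by (simp add: measure_measure_pmf_finite sum_subtractf sum_distrib_left)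
  finally show ?thesis using dp[OF Z(1)] by linarith
qed

lemma amgm_scaled:
  fixes f s :: real
  assumes "0 < s"
  shows "\<bar>f\<bar> \<le> f\<^sup>2 / (2 * s) + s / 2"
proof -
  have "0 \<le> (\<bar>f\<bar> - s)\<^sup>2" by simp
  then have "2 * s * \<bar>f\<bar> \<le> f\<^sup>2 + s\<^sup>2" by (simp add: power2_diff mult_ac)
  then have "\<bar>f\<bar> \<le> (f\<^sup>2 + s\<^sup>2) / (2 * s)" using assms by (simp add: pos_le_divide_eq mult_ac)
  also have "\<dots> = f\<^sup>2 / (2 * s) + s / 2" using assms by (simp add: add_divide_distrib power2_eq_square)
  finally show ?thesis .
qed

text \<open>The difference of the densities splits into a multiplicative part of rate
  \<open>\<epsilon> / 2\<close> and two excess parts of total mass at most \<open>\<delta>\<close>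
  each. AM-GM trades \<open>\<bar>f\<bar>\<close> for second moments with a separate scale for each
  part: \<open>s\<close> for the first, \<open>\<tau>\<close> for the excess. Second moments stay in
  the bound because they are controlled only after averaging over inputs.\<close>

lemma dp_expectation_diff:
  fixes p q :: "'c pmf" and f :: "'c \<Rightarrow> real"
  assumes "finite Y" "0 \<le> \<epsilon>" "0 < s" "0 < \<tau>"
    and supp: "set_pmf p \<subseteq> Y" "set_pmf q \<subseteq> Y"
    and dpq: "\<And>Z. Z \<subseteq> Y \<Longrightarrow> measure_pmf.prob q Z \<le> exp \<epsilon> * measure_pmf.prob p Z + \<delta>"
    and dpp: "\<And>Z. Z \<subseteq> Y \<Longrightarrow> measure_pmf.prob p Z \<le> exp \<epsilon> * measure_pmf.prob q Z + \<delta>"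
  shows "(\<Sum>y\<in>Y. pmf q y * f y) - (\<Sum>y\<in>Y. pmf p y * f y) \<le>
     (\<epsilon> / (4 * s) + 1 / (2 * \<tau>)) * ((\<Sum>y\<in>Y. pmf p y * (f y)\<^sup>2) + (\<Sum>y\<in>Y. pmf q y * (f y)\<^sup>2))
       + \<epsilon> * s / 2 + \<delta> * \<tau>"
proof -
  define \<eta>p where "\<eta>p y = max 0 (pmf p y - exp \<epsilon> * pmf q y)" for y
  define \<eta>q where "\<eta>q y = max 0 (pmf q y - exp \<epsilon> * pmf p y)" for y
  have abs_diff: "\<bar>pmf q y - pmf p y\<bar> \<le> \<epsilon> / 2 * (pmf p y + pmf q y) + \<eta>p y + \<eta>q y" for y
    using excess_bound[OF assms(2), of "pmf p y" "pmf q y"] excess_bound[OF assms(2), of "pmf q y" "pmf p y"]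
    by (auto simp: \<eta>p_def \<eta>q_def algebra_simps)
  have \<eta>: "0 \<le> \<eta>p y" "\<eta>p y \<le> pmf p y" "0 \<le> \<eta>q y" "\<eta>q y \<le> pmf q y" for y
    by (auto simp: \<eta>p_def \<eta>q_def)
  have pw: "(pmf q y - pmf p y) * f y \<le>
      (\<epsilon> / (4 * s) + 1 / (2 * \<tau>)) * (pmf p y * (f y)\<^sup>2 + pmf q y * (f y)\<^sup>2)
        + \<epsilon> * s / 4 * (pmf p y + pmf q y) + \<tau> / 2 * (\<eta>p y + \<eta>q y)" for y
  proof -
    have "(pmf q y - pmf p y) * f y \<le> \<bar>pmf q y - pmf p y\<bar> * \<bar>f y\<bar>"
      by (metis abs_ge_self abs_mult)
    also have "\<dots> \<le> (\<epsilon> / 2 * (pmf p y + pmf q y) + \<eta>p y + \<eta>q y) * \<bar>f y\<bar>"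
      using abs_diff by (intro mult_right_mono) auto
    also have "\<dots> = \<epsilon> / 2 * (pmf p y + pmf q y) * \<bar>f y\<bar> + (\<eta>p y + \<eta>q y) * \<bar>f y\<bar>"
      by (simp add: algebra_simps)
    also have "\<epsilon> / 2 * (pmf p y + pmf q y) * \<bar>f y\<bar> \<le> \<epsilon> / 2 * (pmf p y + pmf q y) * ((f y)\<^sup>2 / (2 * s) + s / 2)"
      using assms(2) amgm_scaled[OF assms(3)] by (intro mult_left_mono) auto
    also have "(\<eta>p y + \<eta>q y) * \<bar>f y\<bar> \<le> (\<eta>p y + \<eta>q y) * ((f y)\<^sup>2 / (2 * \<tau>) + \<tau> / 2)"
      using \<eta>[of y] amgm_scaled[OF assms(4)] by (intro mult_left_mono) auto
    \<comment> \<open>The excess is replaced by the full density only next to the square of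
      \<open>f\<close>; next to the constant \<open>\<tau> / 2\<close> it is kept, so that it sums
      to \<open>\<delta>\<close>.\<close>
    also have "\<dots> \<le> (pmf p y + pmf q y) * ((f y)\<^sup>2 / (2 * \<tau>)) + (\<eta>p y + \<eta>q y) * (\<tau> / 2)"
      unfolding distrib_left
      using \<eta>[of y] assms(4) by (intro add_right_mono mult_right_mono) auto
    finally show ?thesis by (simp add: algebra_simps add_divide_distrib)
  qed
  have "(\<Sum>y\<in>Y. pmf q y * f y) - (\<Sum>y\<in>Y. pmf p y * f y) = (\<Sum>y\<in>Y. (pmf q y - pmf p y) * f y)"
    by (simp add: sum_subtractf left_diff_distrib)
  also have "\<dots> \<le> (\<Sum>y\<in>Y. (\<epsilon> / (4 * s) + 1 / (2 * \<tau>)) * (pmf p y * (f y)\<^sup>2 + pmf q y * (f y)\<^sup>2)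
        + \<epsilon> * s / 4 * (pmf p y + pmf q y) + \<tau> / 2 * (\<eta>p y + \<eta>q y))"
    by (intro sum_mono pw)
  also have "\<dots> = (\<epsilon> / (4 * s) + 1 / (2 * \<tau>)) * ((\<Sum>y\<in>Y. pmf p y * (f y)\<^sup>2) + (\<Sum>y\<in>Y. pmf q y * (f y)\<^sup>2))
        + \<epsilon> * s / 4 * ((\<Sum>y\<in>Y. pmf p y) + (\<Sum>y\<in>Y. pmf q y)) + \<tau> / 2 * ((\<Sum>y\<in>Y. \<eta>p y) + (\<Sum>y\<in>Y. \<eta>q y))"
    by (simp only: sum.distrib flip: sum_distrib_left)
  finally have "(\<Sum>y\<in>Y. pmf q y * f y) - (\<Sum>y\<in>Y. pmf p y * f y) \<le> \<dots>" .
  moreover have "(\<Sum>y\<in>Y. pmf p y) = 1" "(\<Sum>y\<in>Y. pmf q y) = 1"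
    using assms(1) supp by (auto intro: sum_pmf_eq_1)
  moreover have "\<tau> / 2 * ((\<Sum>y\<in>Y. \<eta>p y) + (\<Sum>y\<in>Y. \<eta>q y)) \<le> \<tau> / 2 * (\<delta> + \<delta>)"
    unfolding \<eta>p_def \<eta>q_def
    using excess_sum_le[OF assms(1,2) dpq] excess_sum_le[OF assms(1,2) dpp] assms(4)
    by (intro mult_left_mono add_mono) auto
  ultimately show ?thesis by (simp add: mult.commute)
qed

subsection \<open>A reversible walk with constant drift\<close>

text \<open>\<open>t s\<close> is the mass of \<open>{s..L}\<close>, hence \<open>t (Suc L) = 0\<close>.\<close>

locale tail_chain =
  fixes a :: real and t :: "nat \<Rightarrow> real" and L :: nat
  assumes t_0: "t 0 = 1" and t_1: "t (Suc 0) = 1 / 2" and t_top: "t (Suc L) = 0"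
    and t_nonneg: "0 \<le> t s"
    and a_pos: "0 < a" and a_le: "a \<le> 1"
    and hazard: "0 < s \<Longrightarrow> s \<le> L \<Longrightarrow> a * (t s + t (Suc s)) \<le> t s - t (Suc s)"
begin

definition \<mu> :: "nat \<Rightarrow> real" where
  "\<mu> s = t s - t (Suc s)"

text \<open>
  With flow \<open>a * t (Suc s)\<close> between \<open>s\<close> and \<open>Suc s\<close>, the upward minus the downward flow at \<open>s > 0\<close>
  telescopes to \<open>- a * \<mu> s\<close>, even at the boundary \<open>s = L\<close>.
\<close>

definition jump :: "nat \<Rightarrow> nat \<Rightarrow> real" where
  "jump s s' = (if s' = Suc s then a * t s' else if s = Suc s' then a * t s else 0)"

text \<open>The joint law of the current and the next state in stationarity. The diagonal takes the
  mass that does not move, so the rows sum to \<open>\<mu>\<close>; symmetry of the matrix is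
  reversibility.\<close>

definition joint :: "nat \<Rightarrow> nat \<Rightarrow> real" where
  "joint s s' = (if s = s' then \<mu> s - (\<Sum>u\<le>L. jump s u) else jump s s')"

lemma jump_sym: "jump s s' = jump s' s"
  by (auto simp: jump_def)

lemma joint_sym: "joint s s' = joint s' s"
  by (auto simp: joint_def jump_sym)

lemma sum_jump_0:
  assumes "F 0 = 0"
  shows "(\<Sum>u\<le>L. jump 0 u * F u) = a / 2 * F (Suc 0)"
proof (cases L)
  \<comment> \<open>\<open>L = 0\<close> is contradictory: \<open>t 1\<close> would be both 1/2 and
    0.\<close>
  case 0
  then show ?thesis using t_1 t_top by simp
next
  case (Suc l)
  have "(\<Sum>u\<le>L. jump 0 u * F u) = (\<Sum>u\<le>L. if u = Suc 0 then a * t (Suc 0) * F (Suc 0) else 0)"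
    by (intro sum.cong) (auto simp: jump_def)
  also have "\<dots> = a / 2 * F (Suc 0)" using Suc t_1 by simp
  finally show ?thesis .
qed

lemma sum_jump_Suc:
  assumes "Suc s \<le> L"
  shows "(\<Sum>u\<le>L. jump (Suc s) u * F u) = a * t (Suc (Suc s)) * F (Suc (Suc s)) + a * t (Suc s) * F s"
proof -
  have "(\<Sum>u\<le>L. jump (Suc s) u * F u) = (\<Sum>u\<le>L. (if u = Suc (Suc s) then a * t (Suc (Suc s)) * F (Suc (Suc s)) else 0)
      + (if u = s then a * t (Suc s) * F s else 0))"
    by (intro sum.cong) (auto simp: jump_def)
  also have "\<dots> = a * t (Suc (Suc s)) * F (Suc (Suc s)) + a * t (Suc s) * F s"
    \<comment> \<open>For \<open>Suc s = L\<close> the upward target lies outside the range of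
      summation, but its coefficient \<open>a * t (Suc L)\<close> is 0.\<close>
    using assms t_top by (auto simp: sum.distrib not_le le_Suc_eq dest!: le_antisym[of "Suc s" L])
  finally show ?thesis .
qed

lemma sum_joint: "s \<le> L \<Longrightarrow> (\<Sum>u\<le>L. joint s u) = \<mu> s"
proof -
  assume s: "s \<le> L"
  have "jump s s = 0" by (simp add: jump_def)
  then have "(\<Sum>u\<le>L. joint s u) = (\<Sum>u\<le>L. (if u = s then \<mu> s - (\<Sum>u\<le>L. jump s u) else 0) + jump s u)"
    by (intro sum.cong) (auto simp: joint_def)
  then show ?thesis using s by (simp add: sum.distrib)
qed

lemma sum_joint_jump:
  assumes "F s = 0"
  shows "(\<Sum>u\<le>L. joint s u * F u) = (\<Sum>u\<le>L. jump s u * F u)"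
  using assms by (intro sum.cong) (auto simp: joint_def)

lemma \<mu>_nonneg: "s \<le> L \<Longrightarrow> 0 \<le> \<mu> s"
proof (cases "s = 0")
  case False
  assume "s \<le> L"
  have "0 \<le> a * (t s + t (Suc s))" using t_nonneg a_pos by simp
  then show ?thesis using hazard[of s] False \<open>s \<le> L\<close> by (simp add: \<mu>_def)
qed (simp add: \<mu>_def t_0 t_1)

text \<open>Makes the diagonal of \<open>joint\<close> nonnegative. For \<open>s > 0\<close> this is
  exactly \<open>hazard\<close>; at 0 the outflow is \<open>a / 2\<close> against a mass of
  1/2.\<close>

lemma sum_jump_le: "s \<le> L \<Longrightarrow> (\<Sum>u\<le>L. jump s u) \<le> \<mu> s"
proof (cases s)
  case 0
  show ?thesis
  proof (cases L)
    case 0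
    then show ?thesis using t_1 t_top by simp
  next
    case (Suc l)
    have "(\<Sum>u\<le>L. jump 0 u) = (\<Sum>u\<le>L. jump 0 u * (if u = 0 then 0 else 1))"
      by (intro sum.cong) (auto simp: jump_def)
    then show ?thesis using sum_jump_0[of "\<lambda>u. if u = 0 then 0 else 1"] a_le \<open>s = 0\<close>
      by (simp add: \<mu>_def t_0 t_1)
  qed
next
  case (Suc s')
  assume "s \<le> L"
  then show ?thesis using sum_jump_Suc[of s' "\<lambda>_. 1"] hazard[of s] Suc
    by (simp add: \<mu>_def algebra_simps)
qed

lemma joint_nonneg: "s \<le> L \<Longrightarrow> 0 \<le> joint s s'"
  using sum_jump_le[of s] t_nonneg a_pos by (auto simp: joint_def jump_def)

lemma joint_far: "1 < \<bar>real s - real s'\<bar> \<Longrightarrow> joint s s' = 0"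
  by (auto simp: joint_def jump_def)

definition drift :: "nat \<Rightarrow> real" where
  "drift s = (if s = 0 then a else - a)"

text \<open>At 0 the only move is upward with flow \<open>a / 2\<close>, which equals
  \<open>a * \<mu> 0\<close> because the atom at 0 has mass 1/2. Elsewhere the net flow is
  \<open>a * (t (Suc s) - t s)\<close>.\<close>

lemma joint_drift:
  assumes "s \<le> L"
  shows "(\<Sum>u\<le>L. joint s u * (real u - real s)) = \<mu> s * drift s"
proof (cases s)
  case 0
  then show ?thesis using sum_joint_jump[of "\<lambda>u. real u - real s" s] sum_jump_0[of real]
    by (simp add: drift_def \<mu>_def t_0 t_1)
next
  case (Suc s')
  then show ?thesis
    using sum_joint_jump[of "\<lambda>u. real u - real s" s] sum_jump_Suc[of s' "\<lambda>u. real u - real s"] assms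
    by (simp add: drift_def \<mu>_def algebra_simps)
qed

lemma joint_second_moment:
  assumes "s \<le> L"
  shows "(\<Sum>u\<le>L. joint s u * (real u - real s)\<^sup>2) \<le> \<mu> s"
proof -
  have "(\<Sum>u\<le>L. joint s u * (real u - real s)\<^sup>2) = (\<Sum>u\<le>L. jump s u * (real u - real s)\<^sup>2)"
    by (rule sum_joint_jump) simp
  also have "\<dots> = (\<Sum>u\<le>L. jump s u)"
    by (intro sum.cong) (auto simp: jump_def)
  finally show ?thesis using sum_jump_le[OF assms] by simp
qed

lemma sum_\<mu>: "(\<Sum>s\<le>L. \<mu> s) = 1"
proof -
  have "(\<Sum>s<m. \<mu> s) = t 0 - t m" for m
    by (induction m) (auto simp: \<mu>_def)
  from this[of "Suc L"] show ?thesis by (simp add: t_0 t_top lessThan_Suc_atMost)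
qed

section \<open>Independent walks on all coordinates and the effect of privacy\<close>

lemma increment_moments:
  assumes A: "finite A" and E: "E \<subseteq> A" "card E = k" and g: "g \<in> A \<rightarrow>\<^sub>E {..L}"
  defines "f \<equiv> \<lambda>g'. \<Sum>e\<in>E. real (g' e) - real (g e)"
  defines "Q \<equiv> \<lambda>g'. \<Prod>e\<in>A. joint (g e) (g' e)"
  shows "(\<Sum>g'\<in>A \<rightarrow>\<^sub>E {..L}. Q g' * f g') = (\<Prod>e\<in>A. \<mu> (g e)) * (\<Sum>e\<in>E. drift (g e))"
    and "(\<Sum>g'\<in>A \<rightarrow>\<^sub>E {..L}. Q g' * (f g')\<^sup>2) \<le> (\<Prod>e\<in>A. \<mu> (g e)) * (real k + (real k * a)\<^sup>2)"
proof -
  have finE: "finite E" using A E(1) finite_subset by blast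
  have gL: "g e \<le> L" if "e \<in> A" for e using g that by auto
  have W0: "0 \<le> (\<Prod>e\<in>A. \<mu> (g e))" by (intro prod_nonneg) (auto simp: \<mu>_nonneg gL)
  have "(\<Sum>g'\<in>A \<rightarrow>\<^sub>E {..L}. Q g' * f g') = (\<Sum>e\<in>E. \<Sum>g'\<in>A \<rightarrow>\<^sub>E {..L}. Q g' * (real (g' e) - real (g e)))"
    unfolding f_def sum_distrib_left by (rule sum.swap)
  also have "\<dots> = (\<Sum>e\<in>E. (\<Prod>e\<in>A. \<mu> (g e)) * drift (g e))"
    unfolding Q_def
  proof (intro sum.cong refl)
    fix e assume "e \<in> E"
    then have "e \<in> A" using E by auto
    then show "(\<Sum>g'\<in>A \<rightarrow>\<^sub>E {..L}. (\<Prod>e\<in>A. joint (g e) (g' e)) * (real (g' e) - real (g e)))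
       = (\<Prod>e\<in>A. \<mu> (g e)) * drift (g e)"
      using A by (intro sum_PiE_moment1[where \<phi> = "\<lambda>s. real s - real (g e)"])
        (auto simp: sum_joint joint_drift gL)
  qed
  finally show "(\<Sum>g'\<in>A \<rightarrow>\<^sub>E {..L}. Q g' * f g') = (\<Prod>e\<in>A. \<mu> (g e)) * (\<Sum>e\<in>E. drift (g e))"
    by (simp add: sum_distrib_left)
  \<comment> \<open>Given \<open>g\<close>, the increments are independent. A diagonal entry of the
    expanded square costs at most 1, an off-diagonal one is a product of two drifts and costs at
    most \<open>a\<^sup>2\<close>. Granting the diagonal \<open>a\<^sup>2\<close> as well yields the
    closed form \<open>(real k * a)\<^sup>2\<close>.\<close>
  have entry: "(\<Sum>g'\<in>A \<rightarrow>\<^sub>E {..L}. Q g' * ((real (g' e) - real (g e)) * (real (g' e') - real (g e'))))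
     \<le> (\<Prod>e\<in>A. \<mu> (g e)) * ((if e = e' then 1 else 0) + a\<^sup>2)" if "e \<in> E" "e' \<in> E" for e e'
  proof (cases "e = e'")
    case True
    have e: "e \<in> A" using that E by auto
    \<comment> \<open>If \<open>\<mu> (g e) = 0\<close>, the quotient is 0 by convention, and the
      second moment is 0 too, so it still equals \<open>\<mu> (g e) * c\<close>.\<close>
    define c where "c = (\<Sum>s\<le>L. joint (g e) s * (real s - real (g e))\<^sup>2) / \<mu> (g e)"
    have sec: "0 \<le> (\<Sum>s\<le>L. joint (g e) s * (real s - real (g e))\<^sup>2)"
      "(\<Sum>s\<le>L. joint (g e) s * (real s - real (g e))\<^sup>2) \<le> \<mu> (g e)"
      using joint_second_moment[OF gL[OF e]] by (auto intro!: sum_nonneg simp: joint_nonneg gL e)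
    have c: "c \<le> 1" "(\<Sum>s\<le>L. joint (g e) s * (real s - real (g e))\<^sup>2) = \<mu> (g e) * c"
      using sec by (auto simp: c_def divide_le_eq)
    have "(\<Sum>g'\<in>A \<rightarrow>\<^sub>E {..L}. Q g' * (real (g' e) - real (g e))\<^sup>2) = (\<Prod>e\<in>A. \<mu> (g e)) * c"
      unfolding Q_def
      using A e c by (intro sum_PiE_moment1[where \<phi> = "\<lambda>s. (real s - real (g e))\<^sup>2"])
        (auto simp: sum_joint gL)
    also have "\<dots> \<le> (\<Prod>e\<in>A. \<mu> (g e)) * (1 + a\<^sup>2)"
      using c(1) W0 by (intro mult_left_mono) (auto simp: add_increasing2)
    finally show ?thesis using True by (simp add: power2_eq_square)
  next
    case False
    have e: "e \<in> A" "e' \<in> A" using that E by auto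
    have "(\<Sum>g'\<in>A \<rightarrow>\<^sub>E {..L}. Q g' * ((real (g' e) - real (g e)) * (real (g' e') - real (g e'))))
       = (\<Prod>e\<in>A. \<mu> (g e)) * (drift (g e) * drift (g e'))"
      unfolding Q_def
      using A e False by (intro sum_PiE_moment2[where \<phi> = "\<lambda>s. real s - real (g e)" and \<psi> = "\<lambda>s. real s - real (g e')"])
        (auto simp: sum_joint joint_drift gL)
    also have "\<dots> \<le> (\<Prod>e\<in>A. \<mu> (g e)) * a\<^sup>2"
      using W0 a_pos by (intro mult_left_mono) (auto simp: drift_def power2_eq_square)
    finally show ?thesis using False by simp
  qed
  have "Q g' * (f g')\<^sup>2 =
     (\<Sum>e\<in>E. \<Sum>e'\<in>E. Q g' * ((real (g' e) - real (g e)) * (real (g' e') - real (g e'))))" for g'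
    unfolding f_def power2_eq_square sum_product by (simp only: sum_distrib_left)
  then have "(\<Sum>g'\<in>A \<rightarrow>\<^sub>E {..L}. Q g' * (f g')\<^sup>2) =
     (\<Sum>e\<in>E. \<Sum>e'\<in>E. \<Sum>g'\<in>A \<rightarrow>\<^sub>E {..L}. Q g' * ((real (g' e) - real (g e)) * (real (g' e') - real (g e'))))"
    by (simp only: sum.swap[of _ E "A \<rightarrow>\<^sub>E {..L}"])
  also have "\<dots> \<le> (\<Sum>e\<in>E. \<Sum>e'\<in>E. (\<Prod>e\<in>A. \<mu> (g e)) * ((if e = e' then 1 else 0) + a\<^sup>2))"
    by (intro sum_mono entry)
  also have "\<dots> = (\<Prod>e\<in>A. \<mu> (g e)) * (real k + (real k * a)\<^sup>2)"
  proof -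
    have "(\<Sum>e\<in>E. \<Sum>e'\<in>E. (if e = e' then 1 else 0) + a\<^sup>2) = real k + (real k * a)\<^sup>2"
      using finE E(2) by (simp add: sum.distrib power_mult_distrib power2_eq_square distrib_left mult_ac)
    then show ?thesis by (simp only: flip: sum_distrib_left)
  qed
  finally show "(\<Sum>g'\<in>A \<rightarrow>\<^sub>E {..L}. Q g' * (f g')\<^sup>2) \<le> (\<Prod>e\<in>A. \<mu> (g e)) * (real k + (real k * a)\<^sup>2)" .
qed

text \<open>The drift of a selected coordinate is \<open>2 * a\<close> times the indicator of
  \<open>g e = 0\<close>, minus \<open>a\<close>. The mean of \<open>f\<close> under
  \<open>p g\<close> is therefore \<open>2 * a\<close> times the right-hand side minus
  \<open>a * real k\<close>; under \<open>p g'\<close> it is the negative of that. Privacy limits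
  the gap between these two means.\<close>

lemma selected_bottom_mass:
  fixes p :: "('e \<Rightarrow> nat) \<Rightarrow> 'c pmf" and sel :: "'c \<Rightarrow> 'e set" and k :: nat
  assumes A: "finite A" and Y: "finite Y" and k: "0 < k" and \<epsilon>: "0 < \<epsilon>" "\<epsilon> \<le> 1"
    and a: "a = \<epsilon> / sqrt (real k)" and \<delta>: "\<delta> \<le> \<epsilon>\<^sup>2 / 128"
    and sel: "\<And>y. y \<in> Y \<Longrightarrow> sel y \<subseteq> A" "\<And>y. y \<in> Y \<Longrightarrow> card (sel y) = k"
    and supp: "\<And>g. g \<in> A \<rightarrow>\<^sub>E {..L} \<Longrightarrow> set_pmf (p g) \<subseteq> Y"
    and dp: "\<And>g g' Z. g \<in> A \<rightarrow>\<^sub>E {..L} \<Longrightarrow> g' \<in> A \<rightarrow>\<^sub>E {..L} \<Longrightarrow>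
        (\<And>e. e \<in> A \<Longrightarrow> \<bar>real (g e) - real (g' e)\<bar> \<le> 1) \<Longrightarrow> Z \<subseteq> Y \<Longrightarrow>
        measure_pmf.prob (p g) Z \<le> exp \<epsilon> * measure_pmf.prob (p g') Z + \<delta>"
  shows "real k / 16 \<le> (\<Sum>g\<in>A \<rightarrow>\<^sub>E {..L}. (\<Prod>e\<in>A. \<mu> (g e)) *
           (\<Sum>y\<in>Y. pmf (p g) y * real (card {e\<in>sel y. g e = 0})))"
proof -
  define X where "X = A \<rightarrow>\<^sub>E {..L}"
  define W where "W g = (\<Prod>e\<in>A. \<mu> (g e))" for g :: "'e \<Rightarrow> nat"
  define Q where "Q g g' = (\<Prod>e\<in>A. joint (g e) (g' e))" for g g' :: "'e \<Rightarrow> nat"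
  define f where "f g g' y = (\<Sum>e\<in>sel y. real (g' e) - real (g e))" for g g' :: "'e \<Rightarrow> nat" and y
  define N where "N g = (\<Sum>y\<in>Y. pmf (p g) y * real (card {e\<in>sel y. g e = 0}))" for g
  have finsel: "finite (sel y)" if "y \<in> Y" for y using sel(1)[OF that] A finite_subset by blast
  have XL: "g e \<le> L" if "g \<in> X" "e \<in> A" for g e using that by (auto simp: X_def)
  have Qsym: "Q g g' = Q g' g" for g g' by (simp add: Q_def joint_sym)
  have fanti: "f g' g y = - f g g' y" for g g' y by (simp add: f_def sum_subtractf)
  have W1: "(\<Sum>g\<in>X. W g) = 1"
    using prod_sum_PiE[of A "\<lambda>_. {..L}" "\<lambda>_. \<mu>"] A by (simp add: X_def W_def sum_\<mu>)
  have W0: "0 \<le> W g" if "g \<in> X" for g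
    unfolding W_def by (intro prod_nonneg) (auto simp: \<mu>_nonneg XL that)
  have QW: "(\<Sum>g'\<in>X. Q g g') = W g" if "g \<in> X" for g
    using prod_sum_PiE[of A "\<lambda>_. {..L}" "\<lambda>e. joint (g e)"] A that
    by (simp add: X_def W_def Q_def sum_joint XL[unfolded X_def])
  have Q0: "0 \<le> Q g g'" if "g \<in> X" for g g'
    unfolding Q_def by (intro prod_nonneg) (auto simp: joint_nonneg XL that)
  have p1: "(\<Sum>y\<in>Y. pmf (p g) y) = 1" if "g \<in> X" for g
    using that supp Y by (intro sum_pmf_eq_1) (auto simp: X_def)

  have first: "(\<Sum>g\<in>X. \<Sum>g'\<in>X. Q g g' * (\<Sum>y\<in>Y. pmf (p g) y * f g g' y))
      = 2 * a * (\<Sum>g\<in>X. W g * N g) - a * real k"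
  proof -
    have "(\<Sum>g'\<in>X. Q g g' * (\<Sum>y\<in>Y. pmf (p g) y * f g g' y)) = 2 * a * (W g * N g) - a * real k * W g"
      if g: "g \<in> X" for g
    proof -
      have "(\<Sum>g'\<in>X. Q g g' * (\<Sum>y\<in>Y. pmf (p g) y * f g g' y))
          = (\<Sum>y\<in>Y. pmf (p g) y * (\<Sum>g'\<in>X. Q g g' * f g g' y))"
        unfolding sum_distrib_left by (subst sum.swap) (simp add: mult_ac)
      also have "\<dots> = (\<Sum>y\<in>Y. pmf (p g) y * (W g * (\<Sum>e\<in>sel y. drift (g e))))"
        unfolding X_def Q_def f_def W_def
        by (intro sum.cong refl arg_cong2[of _ _ _ _ "(*)"] increment_moments(1)[OF A sel])
          (use g in \<open>auto simp: X_def\<close>)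
      also have "\<dots> = (\<Sum>y\<in>Y. W g * (2 * a * (pmf (p g) y * real (card {e\<in>sel y. g e = 0})) - a * real k * pmf (p g) y))"
      proof (intro sum.cong refl)
        fix y assume y: "y \<in> Y"
        have "(\<Sum>e\<in>sel y. drift (g e)) = (\<Sum>e\<in>sel y. 2 * a * (if g e = 0 then 1 else 0) - a)"
          by (intro sum.cong) (auto simp: drift_def)
        also have "\<dots> = 2 * a * real (card {e\<in>sel y. g e = 0}) - a * real k"
          using finsel[OF y] sel(2)[OF y]
          by (simp add: sum_subtractf sum.If_cases Int_def flip: sum_distrib_left)
        finally show "pmf (p g) y * (W g * (\<Sum>e\<in>sel y. drift (g e))) =
            W g * (2 * a * (pmf (p g) y * real (card {e\<in>sel y. g e = 0})) - a * real k * pmf (p g) y)"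
          by (simp only:) (simp add: algebra_simps)
      qed
      also have "\<dots> = W g * (2 * a * N g - a * real k)"
        using p1[OF g] by (simp add: N_def sum_subtractf flip: sum_distrib_left)
      finally show ?thesis by (simp add: algebra_simps)
    qed
    then show ?thesis using W1 by (simp add: sum_subtractf flip: sum_distrib_left)
  qed
  \<comment> \<open>Renaming \<open>g\<close> and \<open>g'\<close> into each other leaves
    \<open>Q\<close> fixed and flips the sign of \<open>f\<close>.\<close>
  have first': "(\<Sum>g\<in>X. \<Sum>g'\<in>X. Q g g' * (\<Sum>y\<in>Y. pmf (p g') y * f g g' y))
      = - (\<Sum>g\<in>X. \<Sum>g'\<in>X. Q g g' * (\<Sum>y\<in>Y. pmf (p g) y * f g g' y))"
    by (subst sum.swap, subst Qsym, subst fanti) (simp add: sum_negf)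

  have ka: "real k + (real k * a)\<^sup>2 \<le> 2 * real k"
  proof -
    have "(real k * a)\<^sup>2 = \<epsilon>\<^sup>2 * real k" using k a by (simp add: power_mult_distrib power_divide power2_eq_square)
    also have "\<dots> \<le> 1 * real k" using \<epsilon> by (intro mult_right_mono) (auto simp: power_le_one)
    finally show ?thesis by simp
  qed
  have second: "(\<Sum>g\<in>X. \<Sum>g'\<in>X. Q g g' * (\<Sum>y\<in>Y. pmf (p g) y * (f g g' y)\<^sup>2)) \<le> 2 * real k"
  proof -
    have "(\<Sum>g'\<in>X. Q g g' * (\<Sum>y\<in>Y. pmf (p g) y * (f g g' y)\<^sup>2)) \<le> 2 * real k * W g" if g: "g \<in> X" for g
    proof -
      have "(\<Sum>g'\<in>X. Q g g' * (\<Sum>y\<in>Y. pmf (p g) y * (f g g' y)\<^sup>2))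
          = (\<Sum>y\<in>Y. pmf (p g) y * (\<Sum>g'\<in>X. Q g g' * (f g g' y)\<^sup>2))"
        unfolding sum_distrib_left by (subst sum.swap) (simp add: mult_ac)
      also have "\<dots> \<le> (\<Sum>y\<in>Y. pmf (p g) y * (W g * (real k + (real k * a)\<^sup>2)))"
        unfolding X_def Q_def f_def W_def
        by (intro sum_mono mult_left_mono increment_moments(2)[OF A sel])
          (use g in \<open>auto simp: X_def\<close>)
      also have "\<dots> \<le> (\<Sum>y\<in>Y. pmf (p g) y * (W g * (2 * real k)))"
        using ka W0[OF g] by (intro sum_mono mult_left_mono) auto
      also have "\<dots> = 2 * real k * W g" using p1[OF g] by (simp flip: sum_distrib_right)
      finally show ?thesis .
    qed
    then have "(\<Sum>g\<in>X. \<Sum>g'\<in>X. Q g g' * (\<Sum>y\<in>Y. pmf (p g) y * (f g g' y)\<^sup>2)) \<le> (\<Sum>g\<in>X. 2 * real k * W g)"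
      by (rule sum_mono)
    then show ?thesis using W1 by (simp flip: sum_distrib_left)
  qed
  have second': "(\<Sum>g\<in>X. \<Sum>g'\<in>X. Q g g' * (\<Sum>y\<in>Y. pmf (p g') y * (f g g' y)\<^sup>2))
      = (\<Sum>g\<in>X. \<Sum>g'\<in>X. Q g g' * (\<Sum>y\<in>Y. pmf (p g) y * (f g g' y)\<^sup>2))"
    by (subst sum.swap, subst Qsym, subst fanti) simp

  define s where "s = sqrt (real k)"
  \<comment> \<open>This scale balances the two costs of the excess: its second-moment term is
    \<open>\<epsilon> * s / 8\<close>, and \<open>\<delta> * \<tau>\<close> is at most the same by
    the bound on \<open>\<delta>\<close>.\<close>
  define \<tau> where "\<tau> = 16 * s / \<epsilon>"
  define c where "c = \<epsilon> / (4 * s) + 1 / (2 * \<tau>)"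
  define r where "r = \<epsilon> * s / 2 + \<delta> * \<tau>"
  have s: "0 < s" "s\<^sup>2 = real k" using k by (auto simp: s_def)
  have \<tau>: "0 < \<tau>" using s \<epsilon> by (simp add: \<tau>_def)
  have c: "0 \<le> c" using s \<tau> \<epsilon> by (simp add: c_def)
  have step: "Q g g' * (\<Sum>y\<in>Y. pmf (p g') y * f g g' y) - Q g g' * (\<Sum>y\<in>Y. pmf (p g) y * f g g' y) \<le>
      c * (Q g g' * (\<Sum>y\<in>Y. pmf (p g) y * (f g g' y)\<^sup>2) + Q g g' * (\<Sum>y\<in>Y. pmf (p g') y * (f g g' y)\<^sup>2)) + r * Q g g'"
    if g: "g \<in> X" "g' \<in> X" for g g'
  proof (cases "\<forall>e\<in>A. \<bar>real (g e) - real (g' e)\<bar> \<le> 1")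
    case True
    have "(\<Sum>y\<in>Y. pmf (p g') y * f g g' y) - (\<Sum>y\<in>Y. pmf (p g) y * f g g' y) \<le>
       c * ((\<Sum>y\<in>Y. pmf (p g) y * (f g g' y)\<^sup>2) + (\<Sum>y\<in>Y. pmf (p g') y * (f g g' y)\<^sup>2)) + \<epsilon> * s / 2 + \<delta> * \<tau>"
      unfolding c_def
      by (intro dp_expectation_diff Y s \<tau> supp dp)
        (use True g \<epsilon> in \<open>auto simp: X_def abs_minus_commute\<close>)
    then have "Q g g' * ((\<Sum>y\<in>Y. pmf (p g') y * f g g' y) - (\<Sum>y\<in>Y. pmf (p g) y * f g g' y)) \<le>
       Q g g' * (c * ((\<Sum>y\<in>Y. pmf (p g) y * (f g g' y)\<^sup>2) + (\<Sum>y\<in>Y. pmf (p g') y * (f g g' y)\<^sup>2)) + r)"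
      using Q0[OF g(1)] by (intro mult_left_mono) (auto simp: r_def)
    then show ?thesis by (simp add: algebra_simps)
  next
    \<comment> \<open>Pairs differing by more than 1 somewhere have weight 0, so privacy is invoked
      only between neighbours.\<close>
    case False
    then have "Q g g' = 0" unfolding Q_def using A by (auto simp: prod_zero_iff not_le intro: joint_far)
    then show ?thesis by simp
  qed
  let ?P = "\<Sum>g\<in>X. \<Sum>g'\<in>X. Q g g' * (\<Sum>y\<in>Y. pmf (p g) y * f g g' y)"
  let ?S = "\<Sum>g\<in>X. \<Sum>g'\<in>X. Q g g' * (\<Sum>y\<in>Y. pmf (p g) y * (f g g' y)\<^sup>2)"
  have "(\<Sum>g\<in>X. \<Sum>g'\<in>X. Q g g' * (\<Sum>y\<in>Y. pmf (p g') y * f g g' y) - Q g g' * (\<Sum>y\<in>Y. pmf (p g) y * f g g' y)) \<le>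
      (\<Sum>g\<in>X. \<Sum>g'\<in>X. c * (Q g g' * (\<Sum>y\<in>Y. pmf (p g) y * (f g g' y)\<^sup>2) + Q g g' * (\<Sum>y\<in>Y. pmf (p g') y * (f g g' y)\<^sup>2)) + r * Q g g')"
    by (intro sum_mono step)
  also have "\<dots> = c * (?S + (\<Sum>g\<in>X. \<Sum>g'\<in>X. Q g g' * (\<Sum>y\<in>Y. pmf (p g') y * (f g g' y)\<^sup>2)))
       + r * (\<Sum>g\<in>X. \<Sum>g'\<in>X. Q g g')"
    by (simp only: sum.distrib flip: sum_distrib_left)
  also have "(\<Sum>g\<in>X. \<Sum>g'\<in>X. Q g g') = 1" using QW W1 by simp
  finally have "- ?P - ?P \<le> c * (?S + ?S) + r"
    unfolding sum_subtractf first' second' by simp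
  also have "c * (?S + ?S) \<le> c * (2 * real k + 2 * real k)"
    using second c by (intro mult_left_mono add_mono) auto
  finally have main: "- 2 * ?P \<le> c * (4 * real k) + r" by simp
  have "c * (4 * real k) = 9 / 8 * (\<epsilon> * s)"
    using s \<epsilon> unfolding c_def \<tau>_def s(2)[symmetric] by (simp add: field_simps power2_eq_square)
  moreover have "r \<le> 5 / 8 * (\<epsilon> * s)"
  proof -
    have "\<delta> * \<tau> \<le> \<epsilon>\<^sup>2 / 128 * \<tau>" using \<delta> \<tau> by (intro mult_right_mono) auto
    also have "\<dots> = \<epsilon> * s / 8" using \<epsilon> by (simp add: \<tau>_def power2_eq_square)
    finally show ?thesis by (simp add: r_def)
  qed
  moreover have "a * real k = \<epsilon> * s"
    using s unfolding a s_def[symmetric] s(2)[symmetric] by (simp add: power2_eq_square)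
  \<comment> \<open>The total is 9/8 + 5/8 = 7/4. Any constant below 2 would do: the left side is
    \<open>2 * a * real k\<close> minus \<open>4 * a\<close> times the wanted mean, so the remaining
    quarter gives \<open>real k / 16\<close>.\<close>
  ultimately have "- 2 * ?P \<le> 7 / 4 * (a * real k)" using main by linarith
  then have "a * (real k / 16) \<le> a * (\<Sum>g\<in>X. W g * N g)"
    unfolding first by (simp add: algebra_simps)
  then show ?thesis using a_pos by (simp add: X_def W_def N_def)
qed

end

subsection \<open>The hub graph\<close>

lemma connected_edges_mono: "connected_edges V F \<Longrightarrow> F \<subseteq> F' \<Longrightarrow> connected_edges V F'"
proof -
  assume "connected_edges V F" "F \<subseteq> F'"
  moreover from this have "(adj F)\<^sup>* \<subseteq> (adj F')\<^sup>*"
    by (intro rtrancl_mono) (auto simp: adj_def)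
  ultimately show ?thesis unfolding connected_edges_def by blast
qed

section \<open>Trees encoded by parent functions with decreasing labels\<close>

definition parent_edges :: "nat \<Rightarrow> (nat \<Rightarrow> nat) \<Rightarrow> nat set set" where
  "parent_edges n par = (\<lambda>v. {v, par v}) ` {2..n}"

lemma connected_parent_edges:
  assumes "\<And>v. v \<in> {2..n} \<Longrightarrow> 1 \<le> par v \<and> par v < v"
  shows "connected_edges {1..n} (parent_edges n par)"
proof -
  let ?R = "adj (parent_edges n par)"
  have to_1: "(v, 1) \<in> ?R\<^sup>*" if "v \<in> {1..n}" for v
    using that
  proof (induction v rule: less_induct)
    case (less v)
    show ?case
    proof (cases "v = 1")
      case False
      then have v: "v \<in> {2..n}" using less.prems by auto
      then have "(v, par v) \<in> ?R" by (auto simp: adj_def parent_edges_def)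
      moreover have "(par v, 1) \<in> ?R\<^sup>*" using assms[OF v] v by (intro less.IH) auto
      ultimately show ?thesis by (rule converse_rtrancl_into_rtrancl)
    qed simp
  qed
  have "sym ?R" by (auto simp: sym_def adj_def insert_commute)
  then have "sym (?R\<^sup>*)" by (rule sym_rtrancl)
  then show ?thesis unfolding connected_edges_def by (meson rtrancl_trans symD to_1)
qed

text \<open>Both cycle neighbours of the largest vertex \<open>m\<close> of a cycle are smaller, so
  both must be \<open>par m\<close>; but on a cycle of length at least 3 they are distinct.\<close>

lemma acyclic_parent_edges:
  assumes par: "\<And>v. v \<in> {2..n} \<Longrightarrow> par v < v"
  shows "acyclic_edges (parent_edges n par)"
  unfolding acyclic_edges_def
proof
  assume "\<exists>vs. is_cycle (parent_edges n par) vs"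
  then obtain vs where len: "3 \<le> length vs" and dist: "distinct vs"
    and step: "\<And>i. i < length vs \<Longrightarrow> {vs ! i, vs ! (Suc i mod length vs)} \<in> parent_edges n par"
    unfolding is_cycle_def by blast
  define m where "m = Max (set vs)"
  have "m \<in> set vs" unfolding m_def using len by (intro Max_in) auto
  then obtain i where i: "i < length vs" "vs ! i = m" by (auto simp: in_set_conv_nth)
  have smaller: "vs ! j < m" if "j < length vs" "j \<noteq> i" for j
  proof -
    have "vs ! j \<le> m" unfolding m_def using that by (intro Max_ge) auto
    moreover have "vs ! j \<noteq> m" using that i dist by (auto simp: nth_eq_iff_index_eq)
    ultimately show ?thesis by simp
  qed
  have parent: "u = par m" if u: "{m, u} \<in> parent_edges n par" "u < m" for u
  proof -
    obtain v where v: "v \<in> {2..n}" "{m, u} = {v, par v}" using u(1) unfolding parent_edges_def by blast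
    then show ?thesis using par[OF v(1)] u(2) by (auto simp: doubleton_eq_iff)
  qed
  define j where "j = Suc i mod length vs"
  \<comment> \<open>The cyclic predecessor of \<open>i\<close>, with wrap-around at 0.\<close>
  define l where "l = (if i = 0 then length vs - 1 else i - 1)"
  have j: "j = (if Suc i = length vs then 0 else Suc i)" using i by (simp add: j_def)
  have l: "Suc l mod length vs = i" using i len by (auto simp: l_def)
  have less: "j < length vs" "l < length vs" "j \<noteq> i" "l \<noteq> i" "j \<noteq> l"
    using i len by (auto simp: j l_def)
  have "vs ! j = par m"
    using step[OF i(1)] smaller[OF less(1,3)] i by (intro parent) (auto simp: j_def)
  moreover have "vs ! l = par m"
    using step[OF less(2)] smaller[OF less(2,4)] i l by (intro parent) (auto simp: insert_commute)
  ultimately show False using dist less by (metis nth_eq_iff_index_eq)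
qed

text \<open>The vertices \<open>{1..d}\<close> are the hubs, all joined to hub 1 by free edges; \<open>{d<..n}\<close> are the leaves.\<close>

definition leaf_edges :: "nat \<Rightarrow> nat \<Rightarrow> nat set set" where
  "leaf_edges n d = (\<lambda>(i, j). {i, j}) ` ({d<..n} \<times> {1..d})"

text \<open>The edge set is independent of \<open>g\<close>, so all these graphs share their
  spanning trees, and moving \<open>g\<close> by at most 1 per edge gives a neighbouring graph. The
  restricted abstraction makes the weights extensional.\<close>

definition hub_graph :: "nat \<Rightarrow> nat \<Rightarrow> nat \<Rightarrow> (nat set \<Rightarrow> nat) \<Rightarrow> wgraph" where
  "hub_graph n d L g = \<lparr>nverts = n, edges = (\<lambda>j. {j, 1}) ` {2..d} \<union> leaf_edges n d,
     weight = (\<lambda>e\<in>(\<lambda>j. {j, 1}) ` {2..d} \<union> leaf_edges n d.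
       if e \<in> leaf_edges n d then real L - real (g e) else 0)\<rparr>"

lemma hub_graph_simps [simp]:
  "nverts (hub_graph n d L g) = n" "verts (hub_graph n d L g) = {1..n}"
  "edges (hub_graph n d L g) = (\<lambda>j. {j, 1}) ` {2..d} \<union> leaf_edges n d"
  by (simp_all add: hub_graph_def verts_def)

lemma weight_hub_graph:
  "e \<in> leaf_edges n d \<Longrightarrow> weight (hub_graph n d L g) e = real L - real (g e)"
  "e \<in> edges (hub_graph n d L g) \<Longrightarrow> e \<notin> leaf_edges n d \<Longrightarrow> weight (hub_graph n d L g) e = 0"
  by (auto simp: hub_graph_def)

lemma finite_leaf_edges: "finite (leaf_edges n d)"
  by (simp add: leaf_edges_def)

lemma leaf_edge_eq:
  assumes "e \<in> (\<lambda>j. {j, 1}) ` {2..d} \<union> leaf_edges n d" "1 \<le> d" "i \<in> {d<..n}" "i \<in> e"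
  obtains j where "j \<in> {1..d}" "e = {i, j}"
  using assms by (auto simp: leaf_edges_def)

text \<open>Hubs carry smaller labels than leaves, so hanging hubs on vertex 1 and leaves on
  \<open>b\<close> is a decreasing parent function.\<close>

lemma spanning_tree_hub_graph_parent:
  assumes d: "1 \<le> d" "d \<le> n" and b: "\<And>i. i \<in> {d<..n} \<Longrightarrow> b i \<in> {1..d}"
  shows "spanning_tree (hub_graph n d L g) ((\<lambda>j. {j, 1}) ` {2..d} \<union> (\<lambda>i. {i, b i}) ` {d<..n})"
proof -
  define par where "par v = (if v \<le> d then 1 else b v)" for v
  have par: "1 \<le> par v \<and> par v < v" if "v \<in> {2..n}" for v
    using b[of v] that by (auto simp: par_def)
  have eq: "(\<lambda>j. {j, 1}) ` {2..d} \<union> (\<lambda>i. {i, b i}) ` {d<..n} = parent_edges n par"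
  proof -
    have "parent_edges n par = (\<lambda>v. {v, par v}) ` ({2..d} \<union> {d<..n})"
      unfolding parent_edges_def using d by (intro arg_cong2[of _ _ _ _ "(`)"]) auto
    then show ?thesis by (simp add: image_Un par_def cong: image_cong_simp)
  qed
  have "parent_edges n par \<subseteq> edges (hub_graph n d L g)"
    using b by (auto simp: leaf_edges_def simp flip: eq)
  then show ?thesis
    unfolding spanning_tree_def eq
    using connected_parent_edges[of n par] acyclic_parent_edges[of n par] par by auto
qed

lemma input_hub_graph:
  assumes "1 \<le> d" "d \<le> n"
  shows "input_graph (hub_graph n d L g)"
proof -
  have "spanning_tree (hub_graph n d L g) ((\<lambda>j. {j, 1}) ` {2..d} \<union> (\<lambda>i. {i, 1}) ` {d<..n})"
    using assms by (intro spanning_tree_hub_graph_parent[where b = "\<lambda>_. 1"]) auto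
  then have "connected_edges {1..n} (edges (hub_graph n d L g))"
    using connected_edges_mono unfolding spanning_tree_def by (metis hub_graph_simps(2))
  moreover have "wf_graph (hub_graph n d L g)"
    using assms by (auto simp: wf_graph_def leaf_edges_def hub_graph_def verts_def card_insert_if)
  ultimately show ?thesis by (simp add: input_graph_def)
qed

text \<open>A spanning tree may route a connection between hubs through a leaf, so a leaf can have
  several tree edges; an arbitrary one is picked.\<close>

definition leaf_edge :: "nat set set \<Rightarrow> nat \<Rightarrow> nat set" where
  "leaf_edge T i = (SOME e. e \<in> T \<and> i \<in> e)"

lemma leaf_edge_spanning_tree:
  assumes T: "spanning_tree (hub_graph n d L g) T" and d: "1 \<le> d" and i: "i \<in> {d<..n}"
  shows "leaf_edge T i \<in> T" "\<exists>j\<in>{1..d}. leaf_edge T i = {i, j}"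
proof -
  have "(i, 1) \<in> (adj T)\<^sup>*" "i \<noteq> 1"
    using T i d by (auto simp: spanning_tree_def connected_edges_def)
  then obtain u where "(i, u) \<in> adj T" by (metis converse_rtranclE)
  then have "\<exists>e. e \<in> T \<and> i \<in> e" by (auto simp: adj_def)
  then have *: "leaf_edge T i \<in> T \<and> i \<in> leaf_edge T i"
    unfolding leaf_edge_def by (rule someI_ex)
  then show "leaf_edge T i \<in> T" by simp
  have "leaf_edge T i \<in> (\<lambda>j. {j, 1}) ` {2..d} \<union> leaf_edges n d"
    using * T unfolding spanning_tree_def hub_graph_simps by blast
  then show "\<exists>j\<in>{1..d}. leaf_edge T i = {i, j}"
    using * by (elim leaf_edge_eq[OF _ d i]) auto
qed

text \<open>A leaf edge has only one endpoint among the leaves, so it determines its leaf. The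
  selected set thus always has size \<open>n - d\<close>, as \<open>selected_bottom_mass\<close>
  demands.\<close>

lemma leaf_edge_image:
  assumes T: "spanning_tree (hub_graph n d L g) T" and d: "1 \<le> d"
  shows "inj_on (leaf_edge T) {d<..n}" "leaf_edge T ` {d<..n} \<subseteq> leaf_edges n d"
    "leaf_edge T ` {d<..n} \<subseteq> T" "card (leaf_edge T ` {d<..n}) = n - d"
proof -
  note le = leaf_edge_spanning_tree[OF T d]
  show inj: "inj_on (leaf_edge T) {d<..n}"
  proof (rule inj_onI)
    fix i i' assume i: "i \<in> {d<..n}" "i' \<in> {d<..n}" "leaf_edge T i = leaf_edge T i'"
    then show "i = i'" using le(2)[of i] le(2)[of i'] by (auto simp: doubleton_eq_iff)
  qed
  show "leaf_edge T ` {d<..n} \<subseteq> leaf_edges n d"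
    using le(2) by (fastforce simp: leaf_edges_def)
  show "leaf_edge T ` {d<..n} \<subseteq> T" using le(1) by auto
  show "card (leaf_edge T ` {d<..n}) = n - d" using inj by (simp add: card_image)
qed

text \<open>The minimum tree is compared with the tree \<open>B\<close> that attaches each leaf
  along its cheapest edge. A selected edge with \<open>g e = 0\<close> wastes \<open>L\<close>
  unless its leaf has no edge at level \<open>L\<close>; these leaves are subtracted.\<close>

lemma excess_weight_ge:
  assumes d: "1 \<le> d" "d \<le> n" and g: "\<And>e. e \<in> leaf_edges n d \<Longrightarrow> g e \<le> L"
    and T: "spanning_tree (hub_graph n d L g) T"
    and opt: "minimum_spanning_tree (hub_graph n d L g) T'"
  shows "real L * (real (card {e \<in> leaf_edge T ` {d<..n}. g e = 0}) -
            real (card {i \<in> {d<..n}. \<forall>j\<in>{1..d}. g {i, j} \<noteq> L}))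
        \<le> tree_weight (hub_graph n d L g) T - tree_weight (hub_graph n d L g) T'"
proof -
  let ?G = "hub_graph n d L g"
  note le = leaf_edge_spanning_tree[OF T d(1)] and img = leaf_edge_image[OF T d(1)]
  have "\<exists>j\<in>{1..d}. \<forall>j'\<in>{1..d}. g {i, j'} \<le> g {i, j}" for i
  proof -
    have "Max ((\<lambda>j. g {i, j}) ` {1..d}) \<in> (\<lambda>j. g {i, j}) ` {1..d}" using d(1) by (intro Max_in) auto
    then obtain j where "j \<in> {1..d}" "Max ((\<lambda>j. g {i, j}) ` {1..d}) = g {i, j}" by blast
    then show ?thesis by (metis Max_ge finite_atLeastAtMost finite_imageI imageI)
  qed
  then obtain b where b: "\<And>i. b i \<in> {1..d}" "\<And>i j. j \<in> {1..d} \<Longrightarrow> g {i, j} \<le> g {i, b i}"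
    by metis
  define B where "B = (\<lambda>j. {j, 1}) ` {2..d} \<union> (\<lambda>i. {i, b i}) ` {d<..n}"
  have "spanning_tree ?G B" unfolding B_def using d b by (intro spanning_tree_hub_graph_parent) auto
  then have "tree_weight ?G T' \<le> tree_weight ?G B" using opt by (auto simp: minimum_spanning_tree_def)
  also have "\<dots> = (\<Sum>i\<in>{d<..n}. real L - real (g {i, b i}))"
  proof -
    have disj: "{j, 1} \<notin> leaf_edges n d" if "j \<in> {2..d}" for j
      using that by (auto simp: leaf_edges_def doubleton_eq_iff)
    have mem: "{i, b i} \<in> leaf_edges n d" if "i \<in> {d<..n}" for i
      using that b(1) by (auto simp: leaf_edges_def)
    have inj: "inj_on (\<lambda>i. {i, b i}) {d<..n}"
    proof (rule inj_onI)
      fix i i' assume "i \<in> {d<..n}" "i' \<in> {d<..n}" "{i, b i} = {i', b i'}"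
      then show "i = i'" using b(1)[of i] b(1)[of i'] by (auto simp: doubleton_eq_iff)
    qed
    have "tree_weight ?G B = (\<Sum>e\<in>(\<lambda>i. {i, b i}) ` {d<..n}. weight ?G e)"
      unfolding tree_weight_def B_def
      using disj by (intro sum.mono_neutral_right) (auto intro!: weight_hub_graph(2))
    also have "\<dots> = (\<Sum>i\<in>{d<..n}. weight ?G {i, b i})"
      using inj by (simp add: sum.reindex)
    also have "\<dots> = (\<Sum>i\<in>{d<..n}. real L - real (g {i, b i}))"
      using mem by (intro sum.cong) (auto simp: weight_hub_graph(1))
    finally show ?thesis .
  qed
  finally have upper: "tree_weight ?G T' \<le> (\<Sum>i\<in>{d<..n}. real L - real (g {i, b i}))" .
  have Tfin: "T \<subseteq> edges ?G" "finite T"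
    using T finite_leaf_edges[of n d] by (auto simp: spanning_tree_def intro: finite_subset)
  have w0: "0 \<le> weight ?G e" if "e \<in> T" for e
    using Tfin(1) that g[of e] weight_hub_graph[of e n d L g] by (cases "e \<in> leaf_edges n d") auto
  have "(\<Sum>i\<in>{d<..n}. real L - real (g (leaf_edge T i))) = (\<Sum>i\<in>{d<..n}. weight ?G (leaf_edge T i))"
    using img(2) by (intro sum.cong weight_hub_graph(1)[symmetric]) auto
  also have "\<dots> = (\<Sum>e\<in>leaf_edge T ` {d<..n}. weight ?G e)"
    using img(1) by (simp add: sum.reindex)
  \<comment> \<open>Unselected edges of \<open>T\<close> may be dropped because
    \<open>g e \<le> L\<close> makes all weights nonnegative.\<close>
  also have "\<dots> \<le> tree_weight ?G T"
    unfolding tree_weight_def using Tfin img(3) w0 by (intro sum_mono2) auto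
  finally have lower: "(\<Sum>i\<in>{d<..n}. real L - real (g (leaf_edge T i))) \<le> tree_weight ?G T" .
  \<comment> \<open>The left side is positive only if the selected edge is at level 0 while some
    edge of the leaf is at \<open>L\<close>, where the loss is \<open>L\<close>. Otherwise it is at
    most 0, and the loss is never negative.\<close>
  have "real L * ((if g (leaf_edge T i) = 0 then 1 else 0) - (if \<forall>j\<in>{1..d}. g {i, j} \<noteq> L then 1 else 0))
      \<le> (real L - real (g (leaf_edge T i))) - (real L - real (g {i, b i}))" if i: "i \<in> {d<..n}" for i
  proof -
    have "g (leaf_edge T i) \<le> g {i, b i}" using le(2)[OF i] b(2) by auto
    moreover have "L \<le> g {i, b i}" if "j \<in> {1..d}" "g {i, j} = L" for j
      using b(2)[of j i] that by simp
    ultimately show ?thesis by auto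
  qed
  then have "(\<Sum>i\<in>{d<..n}. real L * ((if g (leaf_edge T i) = 0 then 1 else 0) -
        (if \<forall>j\<in>{1..d}. g {i, j} \<noteq> L then 1 else 0)))
      \<le> (\<Sum>i\<in>{d<..n}. (real L - real (g (leaf_edge T i))) - (real L - real (g {i, b i})))"
    by (rule sum_mono)
  also have "\<dots> \<le> tree_weight ?G T - tree_weight ?G T'"
    unfolding sum_subtractf using upper lower by (simp add: sum_subtractf)
  also have "(\<Sum>i\<in>{d<..n}. real L * ((if g (leaf_edge T i) = 0 then 1 else 0) -
        (if \<forall>j\<in>{1..d}. g {i, j} \<noteq> L then 1 else 0)))
     = real L * (real (card {i\<in>{d<..n}. g (leaf_edge T i) = 0}) -
            real (card {i \<in> {d<..n}. \<forall>j\<in>{1..d}. g {i, j} \<noteq> L}))"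
    by (simp add: sum_subtractf sum.If_cases Int_def flip: sum_distrib_left)
  also have "card {i\<in>{d<..n}. g (leaf_edge T i) = 0} = card {e \<in> leaf_edge T ` {d<..n}. g e = 0}"
  proof -
    have "{e \<in> leaf_edge T ` {d<..n}. g e = 0} = leaf_edge T ` {i\<in>{d<..n}. g (leaf_edge T i) = 0}"
      by auto
    moreover have "inj_on (leaf_edge T) {i\<in>{d<..n}. g (leaf_edge T i) = 0}"
      using img(1) by (rule inj_on_subset) auto
    ultimately show ?thesis by (simp only: card_image)
  qed
  finally show ?thesis .
qed

subsection \<open>The lower bound\<close>

context tail_chain
begin

lemma prob_no_top:
  assumes "finite A" "B \<subseteq> A"
  shows "(\<Sum>g\<in>A \<rightarrow>\<^sub>E {..L}. (\<Prod>e\<in>A. \<mu> (g e)) * of_bool (\<forall>e\<in>B. g e \<noteq> L)) = (1 - \<mu> L) ^ card B"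
proof -
  have "finite B" using assms finite_subset by blast
  have "(\<Prod>e\<in>A. \<mu> (g e)) * of_bool (\<forall>e\<in>B. g e \<noteq> L) = (\<Prod>e\<in>A. \<mu> (g e) * (if e \<in> B \<and> g e = L then 0 else 1))" for g
  proof -
    have "(\<Prod>e\<in>A. if e \<in> B \<and> g e = L then 0 else 1 :: real) = of_bool (\<forall>e\<in>B. g e \<noteq> L)"
      using assms by (cases "\<forall>e\<in>B. g e \<noteq> L") (auto intro!: prod.neutral)
    then show ?thesis by (simp only: prod.distrib)
  qed
  then have "(\<Sum>g\<in>A \<rightarrow>\<^sub>E {..L}. (\<Prod>e\<in>A. \<mu> (g e)) * of_bool (\<forall>e\<in>B. g e \<noteq> L))
      = (\<Prod>e\<in>A. \<Sum>s\<le>L. \<mu> s * (if e \<in> B \<and> s = L then 0 else 1))"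
    using assms by (simp add: prod_sum_PiE)
  also have "\<dots> = (\<Prod>e\<in>A. if e \<in> B then 1 - \<mu> L else 1)"
  proof (intro prod.cong refl)
    fix e
    have "(\<Sum>s\<le>L. \<mu> s * (if e \<in> B \<and> s = L then 0 else 1))
        = (\<Sum>s\<le>L. \<mu> s - (if s = L then if e \<in> B then \<mu> L else 0 else 0))"
      by (intro sum.cong) auto
    then show "(\<Sum>s\<le>L. \<mu> s * (if e \<in> B \<and> s = L then 0 else 1)) = (if e \<in> B then 1 - \<mu> L else 1)"
      by (simp add: sum_subtractf sum_\<mu>)
  qed
  also have "\<dots> = (1 - \<mu> L) ^ card B"
    using assms by (simp add: prod.If_cases Int_absorb1 Int_commute)
  finally show ?thesis .
qed

text \<open>Averaged over random \<open>g\<close>, at least a fraction 1/16 of the selected edges is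
  at level 0, while at most a fraction 1/32 of the leaves lacks an edge at level \<open>L\<close>.
  Some fixed \<open>g\<close> does at least as well as the average, and its graph is the
  witness.\<close>

lemma expected_excess_weight_ge:
  fixes M :: "wgraph \<Rightarrow> nat set set pmf"
  assumes M: "dp_mst_algorithm \<epsilon> \<delta> M" and d: "1 \<le> d" "d < n" and \<epsilon>: "0 < \<epsilon>" "\<epsilon> \<le> 1"
    and a: "a = \<epsilon> / sqrt (real (n - d))" and \<delta>: "\<delta> n \<le> \<epsilon>\<^sup>2 / 128"
    and top: "(1 - \<mu> L) ^ d \<le> 1 / 32"
  shows "\<exists>G. input_graph G \<and> nverts G = n \<and> (\<forall>T. minimum_spanning_tree G T \<longrightarrow>
    real L * real (n - d) / 32 \<le> measure_pmf.expectation (M G) (tree_weight G) - tree_weight G T)"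
proof -
  define A where "A = leaf_edges n d"
  define X where "X = A \<rightarrow>\<^sub>E {..L}"
  define G where "G = hub_graph n d L"
  \<comment> \<open>Being a spanning tree does not depend on the weights, so the choice
    \<open>\<lambda>_. 0\<close> stands for every \<open>g\<close>.\<close>
  define Y where "Y = {T. spanning_tree (hub_graph n d L (\<lambda>_. 0)) T}"
  define sel where "sel T = leaf_edge T ` {d<..n}" for T
  define W where "W g = (\<Prod>e\<in>A. \<mu> (g e))" for g :: "nat set \<Rightarrow> nat"
  define N where "N g = (\<Sum>T\<in>Y. pmf (M (G g)) T * real (card {e\<in>sel T. g e = 0}))" for g
  define U where "U g = real (card {i\<in>{d<..n}. \<forall>j\<in>{1..d}. g {i, j} \<noteq> L})" for g
  have A: "finite A" by (simp add: A_def finite_leaf_edges)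
  have Y: "T \<in> Y \<longleftrightarrow> spanning_tree (G g) T" for T g
    by (simp add: Y_def G_def spanning_tree_def)
  have finY: "finite Y"
    by (rule finite_subset[of _ "Pow ((\<lambda>j. {j, 1}) ` {2..d} \<union> leaf_edges n d)"])
      (auto simp: Y_def spanning_tree_def finite_leaf_edges)
  have input: "input_graph (G g)" for g using d by (simp add: G_def input_hub_graph)
  have supp: "set_pmf (M (G g)) \<subseteq> Y" for g
    using M input[of g] Y[of _ g] unfolding dp_mst_algorithm_def by blast
  have dp: "measure_pmf.prob (M (G g)) Z \<le> exp \<epsilon> * measure_pmf.prob (M (G g')) Z + \<delta> n"
    if "\<And>e. e \<in> A \<Longrightarrow> \<bar>real (g e) - real (g' e)\<bar> \<le> 1" "Z \<subseteq> Y" for g g' Z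
  proof -
    have "\<bar>weight (G g) e - weight (G g') e\<bar> \<le> 1" if "e \<in> edges (G g)" for e
      using that \<open>\<And>e. e \<in> A \<Longrightarrow> _\<close>[of e] unfolding G_def A_def
      by (cases "e \<in> leaf_edges n d") (auto simp: weight_hub_graph abs_minus_commute)
    then have "neighboring (G g) (G g')" by (simp add: neighboring_def G_def)
    moreover have "Z \<subseteq> {T. spanning_tree (G g) T}" using that(2) by (auto simp: Y[of _ g])
    ultimately have "measure_pmf.prob (M (G g)) Z \<le> exp \<epsilon> * measure_pmf.prob (M (G g')) Z + \<delta> (nverts (G g))"
      using M input unfolding dp_mst_algorithm_def by blast
    then show ?thesis by (simp add: G_def)
  qed
  have "real (n - d) / 16 \<le> (\<Sum>g\<in>X. W g * N g)"
    unfolding X_def W_def N_def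
  proof (intro selected_bottom_mass[where \<epsilon> = \<epsilon> and \<delta> = "\<delta> n"] A finY \<epsilon> a \<delta> supp dp)
    fix T assume "T \<in> Y"
    then have T: "spanning_tree (hub_graph n d L (\<lambda>_. 0)) T" by (simp add: Y_def)
    show "sel T \<subseteq> A" "card (sel T) = n - d"
      using leaf_edge_image[OF T d(1)] by (auto simp: sel_def A_def)
  qed (use d in auto)
  moreover have "(\<Sum>g\<in>X. W g * U g) \<le> real (n - d) / 32"
  proof -
    have "W g * U g = (\<Sum>i\<in>{d<..n}. W g * of_bool (\<forall>e\<in>(\<lambda>j. {i, j}) ` {1..d}. g e \<noteq> L))" for g
      by (simp add: U_def of_bool_def sum.If_cases Int_def flip: sum_distrib_left)
    then have "(\<Sum>g\<in>X. W g * U g) = (\<Sum>i\<in>{d<..n}. \<Sum>g\<in>X. W g * of_bool (\<forall>e\<in>(\<lambda>j. {i, j}) ` {1..d}. g e \<noteq> L))"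
      by (simp only: sum.swap[of _ "{d<..n}" X])
    also have "\<dots> = (\<Sum>i\<in>{d<..n}. (1 - \<mu> L) ^ d)"
    proof (intro sum.cong refl)
      fix i assume i: "i \<in> {d<..n}"
      have "inj_on (\<lambda>j. {i, j}) {1..d}" by (auto simp: inj_on_def doubleton_eq_iff)
      then have "card ((\<lambda>j. {i, j}) ` {1..d}) = d" by (simp add: card_image)
      moreover have "(\<lambda>j. {i, j}) ` {1..d} \<subseteq> A" using i by (auto simp: A_def leaf_edges_def)
      ultimately show "(\<Sum>g\<in>X. W g * of_bool (\<forall>e\<in>(\<lambda>j. {i, j}) ` {1..d}. g e \<noteq> L)) = (1 - \<mu> L) ^ d"
        using prob_no_top[OF A] by (simp only: X_def W_def)
    qed
    also have "\<dots> \<le> (\<Sum>i\<in>{d<..n}. 1 / 32)" by (intro sum_mono top)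
    finally show ?thesis by simp
  qed
  ultimately have avg: "real (n - d) / 32 \<le> (\<Sum>g\<in>X. W g * (N g - U g))"
    by (simp add: right_diff_distrib sum_subtractf)
  have W0: "0 \<le> W g" if "g \<in> X" for g
    unfolding W_def using that by (intro prod_nonneg) (auto simp: X_def intro!: \<mu>_nonneg)
  have W1: "(\<Sum>g\<in>X. W g) = 1"
    using prod_sum_PiE[of A "\<lambda>_. {..L}" "\<lambda>_. \<mu>"] A by (simp add: X_def W_def sum_\<mu>)
  have "\<exists>g\<in>X. real (n - d) / 32 \<le> N g - U g"
  proof (rule ccontr)
    assume neg: "\<not> ?thesis"
    have "(\<Sum>g\<in>X. W g * (N g - U g)) < (\<Sum>g\<in>X. W g * (real (n - d) / 32))"
    proof (rule sum_strict_mono_ex1)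
      show "finite X" using A by (simp add: X_def finite_PiE)
      show "\<forall>g\<in>X. W g * (N g - U g) \<le> W g * (real (n - d) / 32)"
        using neg W0 by (intro ballI mult_left_mono) auto
      \<comment> \<open>Weights may vanish, so strictness of the averaged inequality needs one
        \<open>g\<close> of positive mass.\<close>
      have "\<exists>g\<in>X. W g \<noteq> 0" using W1 by (metis sum.neutral zero_neq_one)
      then show "\<exists>g\<in>X. W g * (N g - U g) < W g * (real (n - d) / 32)"
        using neg W0 by (metis less_le mult_strict_left_mono not_le)
    qed
    then show False using avg W1 by (simp flip: sum_distrib_right sum_divide_distrib)
  qed
  then obtain g where g: "g \<in> X" "real (n - d) / 32 \<le> N g - U g" by blast
  show ?thesis
  proof (intro exI[of _ "G g"] conjI allI impI)
    show "input_graph (G g)" by (rule input)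
    show "nverts (G g) = n" by (simp add: G_def)
    fix T' assume T': "minimum_spanning_tree (G g) T'"
    have p1: "(\<Sum>T\<in>Y. pmf (M (G g)) T) = 1" using supp finY by (intro sum_pmf_eq_1)
    have "measure_pmf.expectation (M (G g)) (tree_weight (G g)) = (\<Sum>T\<in>Y. tree_weight (G g) T * pmf (M (G g)) T)"
      using supp[of g] by (intro integral_measure_pmf_real[OF finY]) auto
    then have "measure_pmf.expectation (M (G g)) (tree_weight (G g)) - tree_weight (G g) T'
        = (\<Sum>T\<in>Y. pmf (M (G g)) T * (tree_weight (G g) T - tree_weight (G g) T'))"
      using p1 by (simp add: right_diff_distrib sum_subtractf mult.commute flip: sum_distrib_left)
    also have "\<dots> \<ge> (\<Sum>T\<in>Y. pmf (M (G g)) T * (real L * (real (card {e\<in>sel T. g e = 0}) - U g)))"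
    proof (intro sum_mono mult_left_mono)
      fix T assume "T \<in> Y"
      then show "real L * (real (card {e\<in>sel T. g e = 0}) - U g) \<le> tree_weight (G g) T - tree_weight (G g) T'"
        unfolding sel_def U_def G_def using d g(1) T' Y[of T g]
        by (intro excess_weight_ge) (auto simp: X_def A_def G_def)
    qed simp
    also have "(\<Sum>T\<in>Y. pmf (M (G g)) T * (real L * (real (card {e\<in>sel T. g e = 0}) - U g)))
        = real L * (N g - (\<Sum>T\<in>Y. pmf (M (G g)) T) * U g)"
      by (simp add: N_def right_diff_distrib sum_subtractf sum_distrib_left sum_distrib_right mult_ac)
    finally have "real L * (N g - U g) \<le> measure_pmf.expectation (M (G g)) (tree_weight (G g)) - tree_weight (G g) T'"
      using p1 by simp
    moreover have "real L * (real (n - d) / 32) \<le> real L * (N g - U g)"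
      using g(2) by (intro mult_left_mono) auto
    ultimately show "real L * real (n - d) / 32 \<le> measure_pmf.expectation (M (G g)) (tree_weight (G g)) - tree_weight (G g) T'"
      by simp
  qed
qed

end

section \<open>The geometric law and the choice of parameters\<close>

lemma tail_chain_geometric:
  assumes "0 < a" "a \<le> 1 / 4" "1 \<le> L"
  shows "tail_chain a (\<lambda>s. if s = 0 then 1 else if s \<le> L then (1 - 2 * a) ^ (s - 1) / 2 else 0) L"
proof
  fix s assume s: "0 < s" "s \<le> L"
  let ?t = "\<lambda>s. if s = 0 then 1 else if s \<le> L then (1 - 2 * a) ^ (s - 1) / 2 else 0"
  obtain u where u: "s = Suc u" using s by (cases s) auto
  have pos: "0 \<le> (1 - 2 * a) ^ u" using assms by simp
  show "a * (?t s + ?t (Suc s)) \<le> ?t s - ?t (Suc s)"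
  proof (cases "s = L")
    case True
    have t: "?t s = (1 - 2 * a) ^ u / 2" "?t (Suc s) = 0" using True u by auto
    have "a * (1 - 2 * a) ^ u \<le> 1 * (1 - 2 * a) ^ u" using assms pos by (intro mult_right_mono) auto
    then show ?thesis unfolding t by simp
  next
    case False
    define q where "q = (1 - 2 * a) ^ u"
    have t: "?t s = q / 2" "?t (Suc s) = (1 - 2 * a) * q / 2" using False u s by (auto simp: q_def)
    \<comment> \<open>With ratio \<open>1 - 2 * a\<close> the two sides of the hazard condition
      differ by exactly \<open>a\<^sup>2 * q\<close>.\<close>
    have "0 \<le> a\<^sup>2 * q" using pos by (simp add: q_def)
    then show ?thesis unfolding t by (simp add: field_simps power2_eq_square)
  qed
qed (use assms in auto)

text \<open>Since \<open>1 - 2 * a \<ge> exp (- (4 * a))\<close>, the factor 8 in the bound on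
  \<open>L\<close> keeps the top mass \<open>u\<close> at least 1 / (2 * sqrt d). So
  \<open>real d * u\<close> is at least 32, and Bernoulli gives \<open>(1 - u) ^ d * (1 + real d *
  u) \<le> (1 - u\<^sup>2) ^ d \<le> 1\<close>.\<close>

lemma geometric_top_rare:
  assumes a: "0 < a" "a \<le> 1 / 4" and d: "4096 \<le> d" and L: "real L \<le> ln (real d) / (8 * a)"
  shows "(1 - (1 - 2 * a) ^ (L - 1) / 2) ^ d \<le> 1 / 32"
proof -
  define u where "u = (1 - 2 * a) ^ (L - 1) / 2"
  have u: "0 \<le> u" "u \<le> 1" using a power_le_one[of "1 - 2 * a" "L - 1"] by (auto simp: u_def)
  have "exp (- (4 * a)) \<le> 1 - 2 * a"
  proof -
    have "exp (- (4 * a)) * (1 + 4 * a) \<le> exp (- (4 * a)) * exp (4 * a)"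
      by (intro mult_left_mono exp_ge_add_one_self) auto
    also have "\<dots> = 1" by (simp flip: exp_add)
    also have "1 \<le> (1 - 2 * a) * (1 + 4 * a)"
    proof -
      have "0 \<le> 2 * a * (1 - 4 * a)" using a by simp
      then show ?thesis by (simp add: algebra_simps)
    qed
    finally show ?thesis using a by simp
  qed
  then have "exp (- (4 * a)) ^ (L - 1) \<le> (1 - 2 * a) ^ (L - 1)" by (intro power_mono) auto
  moreover have "exp (- (4 * a)) ^ (L - 1) = exp (- (4 * a * real (L - 1)))"
    by (simp flip: exp_of_nat_mult add: mult_ac)
  moreover have "exp (- (ln (real d) / 2)) \<le> exp (- (4 * a * real (L - 1)))"
  proof -
    have "4 * a * real (L - 1) \<le> 4 * a * real L" using a by (intro mult_left_mono) auto
    also have "\<dots> \<le> 4 * a * (ln (real d) / (8 * a))" using a L by (intro mult_left_mono) auto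
    also have "\<dots> = ln (real d) / 2" using a by simp
    finally show ?thesis by simp
  qed
  moreover have "exp (- (ln (real d) / 2)) = 1 / sqrt (real d)"
    using d by (simp add: exp_minus inverse_eq_divide flip: ln_sqrt)
  ultimately have "1 / sqrt (real d) \<le> 2 * u" by (simp add: u_def)
  then have "real d * (1 / sqrt (real d)) \<le> real d * (2 * u)" by (intro mult_left_mono) auto
  moreover have "real d * (1 / sqrt (real d)) = sqrt (real d)" by (simp add: real_div_sqrt)
  moreover have "64 \<le> sqrt (real d)" using d by (intro real_le_rsqrt) auto
  ultimately have du: "32 \<le> real d * u" by simp
  have "(1 - u) ^ d * (1 + real d * u) \<le> (1 - u) ^ d * (1 + u) ^ d"
    using u Bernoulli_inequality[of u d] by (intro mult_left_mono) auto
  also have "\<dots> = (1 - u\<^sup>2) ^ d" by (simp add: power2_eq_square algebra_simps flip: power_mult_distrib)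
  also have "\<dots> \<le> 1" using u by (intro power_le_one) (auto simp: power_le_one)
  finally have "(1 - u) ^ d * (1 + real d * u) \<le> 1" .
  moreover have "(1 - u) ^ d * 32 \<le> (1 - u) ^ d * (1 + real d * u)"
    using u du by (intro mult_left_mono) auto
  ultimately show ?thesis by (simp add: u_def)
qed

text \<open>The constant is 1/4 from \<open>sqrt k * k\<close> against the power of
  \<open>n\<close>, 1/2 from \<open>ln d\<close> against \<open>ln n\<close>, and 1/512 = 1/16 *
  1/32 from \<open>L\<close> and the final division.\<close>

lemma excess_scale_ge:
  fixes \<epsilon> :: real
  assumes n: "8192 \<le> n" and \<epsilon>: "0 < \<epsilon>" "\<epsilon> \<le> 1"
  defines "d \<equiv> n div 2"
  defines "a \<equiv> \<epsilon> / sqrt (real (n - d))"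
  defines "L \<equiv> nat \<lfloor>ln (real d) / (8 * a)\<rfloor>"
  shows "0 < a" "a \<le> 1 / 4" "1 \<le> L" "real L \<le> ln (real d) / (8 * a)"
    and "1 / 4096 * (1 / \<epsilon> * real n powr (3 / 2) * ln (real n)) \<le> real L * real (n - d) / 32"
proof -
  define k where "k = real (n - d)"
  have k: "real n / 2 \<le> k" "4096 \<le> k" using n by (auto simp: k_def d_def)
  have d: "4096 \<le> d" "real n \<le> (real d)\<^sup>2"
  proof -
    show "4096 \<le> d" using n by (simp add: d_def)
    have "real n \<le> 3 * real d" using n by (simp add: d_def)
    also have "\<dots> \<le> real d * real d" using \<open>4096 \<le> d\<close> by (intro mult_right_mono) auto
    finally show "real n \<le> (real d)\<^sup>2" by (simp add: power2_eq_square)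
  qed
  have sk: "64 \<le> sqrt k" using k by (intro real_le_rsqrt) auto
  show a0: "0 < a" using \<epsilon> k by (simp add: a_def flip: k_def)
  have "\<epsilon> \<le> 1 / 4 * sqrt k" using \<epsilon> sk by simp
  then show a1: "a \<le> 1 / 4" using sk pos_divide_le_eq[of "sqrt k" \<epsilon> "1 / 4"] by (simp only: a_def flip: k_def)
  have "exp 4 \<le> real d"
  proof -
    have "exp (4::real) = exp 1 ^ 4" by (simp flip: exp_of_nat_mult)
    also have "\<dots> \<le> 3 ^ 4" using exp_le by (intro power_mono) auto
    finally show ?thesis using d(1) by simp
  qed
  then have ln4: "4 \<le> ln (real d)" using d(1) by (simp add: ln_ge_iff)
  then have "16 * a \<le> ln (real d)" using a1 by simp
  then have big: "1 \<le> ln (real d) / (16 * a)" using a0 by simp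
  have "ln (real d) / (8 * a) = 2 * (ln (real d) / (16 * a))" by simp
  then have big2: "2 \<le> ln (real d) / (8 * a)" using big by linarith
  show "real L \<le> ln (real d) / (8 * a)" unfolding L_def using big2 by simp
  have "ln (real d) / (8 * a) - 1 \<le> real L" unfolding L_def using big2 by linarith
  \<comment> \<open>The number before rounding is at least 2, so the floor keeps at least half of
    it.\<close>
  then have L: "ln (real d) / (16 * a) \<le> real L" using big \<open>_ = 2 * _\<close> by linarith
  then show "1 \<le> L" using big by linarith
  have lnn: "ln (real n) / 2 \<le> ln (real d)"
  proof -
    have "ln (real n) \<le> ln ((real d)\<^sup>2)" using d n by (subst ln_le_cancel_iff) auto
    then show ?thesis using d(1) by (simp add: ln_realpow)
  qed
  have "real n powr (3 / 2) / 4 \<le> sqrt k * k"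
  proof -
    have "real n powr (3 / 2) = real n powr (1 + 1 / 2)" by simp
    also have "\<dots> = real n * sqrt (real n)" using n by (subst powr_add) (simp add: powr_half_sqrt)
    also have "\<dots> \<le> (2 * k) * (2 * sqrt k)"
    proof (intro mult_mono)
      have "sqrt (real n) \<le> sqrt (4 * k)" using k by simp
      then show "sqrt (real n) \<le> 2 * sqrt k" by (simp add: real_sqrt_mult)
    qed (use k in auto)
    finally show ?thesis by (simp add: mult.commute)
  qed
  then have "(real n powr (3 / 2) / 4) * (ln (real n) / 2) / (512 * \<epsilon>) \<le> (sqrt k * k) * ln (real d) / (512 * \<epsilon>)"
    using lnn n k \<epsilon> by (intro divide_right_mono mult_mono) auto
  also have "\<dots> = (ln (real d) / (16 * a)) * k / 32"
    using \<epsilon> by (simp add: a_def flip: k_def)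
  also have "\<dots> \<le> real L * k / 32" using L k by (intro divide_right_mono mult_right_mono) auto
  finally show "1 / 4096 * (1 / \<epsilon> * real n powr (3 / 2) * ln (real n)) \<le> real L * real (n - d) / 32"
    by (simp add: k_def)
qed

theorem theorem1p2:
  shows "\<exists>c::real. c > 0 \<and>
    (\<forall>(\<epsilon>::real) (\<delta>::nat \<Rightarrow> real). 0 < \<epsilon> \<and> \<epsilon> \<le> 1 \<and> \<delta> \<in> O(\<lambda>n. 1 / sqrt (real n)) \<longrightarrow>
      (\<forall>\<^sub>F n in sequentially. \<forall>M. dp_mst_algorithm \<epsilon> \<delta> M \<longrightarrow>
        (\<exists>G. input_graph G \<and> nverts G = n \<and>
          (\<forall>T. minimum_spanning_tree G T \<longrightarrow>
            measure_pmf.expectation (M G) (tree_weight G) - tree_weight G T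
              \<ge> c * (1 / \<epsilon> * real n powr (3 / 2) * ln (real n))))))"
proof (intro exI[of _ "1 / 4096 :: real"] conjI allI impI, goal_cases)
  case (2 \<epsilon> \<delta>)
  then have \<epsilon>: "0 < \<epsilon>" "\<epsilon> \<le> 1" and \<delta>: "\<delta> \<in> O(\<lambda>n. 1 / sqrt (real n))" by auto
  have "((\<lambda>n. 1 / sqrt (real n)) \<longlongrightarrow> 0) sequentially"
    by (intro tendsto_divide_0[OF tendsto_const] filterlim_at_top_imp_at_infinity
        filterlim_compose[OF sqrt_at_top filterlim_real_sequentially])
  then have "(\<lambda>n. 1 / sqrt (real n)) \<in> o(\<lambda>_. 1)" by (intro smalloI_tendsto) auto
  from smalloD_tendsto[OF landau_o.big_small_trans[OF \<delta> this]]
  have "(\<delta> \<longlongrightarrow> 0) sequentially" by simp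
  \<comment> \<open>The threshold for \<open>n\<close> depends on \<open>\<epsilon>\<close> and
    \<open>\<delta>\<close> here, but not on \<open>M\<close>.\<close>
  then have "\<forall>\<^sub>F n in sequentially. \<delta> n < \<epsilon>\<^sup>2 / 128"
    by (rule order_tendstoD) (use \<epsilon> in simp)
  then show ?case using eventually_ge_at_top[of 8192]
  proof eventually_elim
    case (elim n)
    define d where "d = n div 2"
    define a where "a = \<epsilon> / sqrt (real (n - d))"
    define L where "L = nat \<lfloor>ln (real d) / (8 * a)\<rfloor>"
    note scale = excess_scale_ge[OF elim(2) \<epsilon>, folded d_def, folded a_def, folded L_def]
    interpret tail_chain a "\<lambda>s. if s = 0 then 1 else if s \<le> L then (1 - 2 * a) ^ (s - 1) / 2 else 0" L
      by (rule tail_chain_geometric[OF scale(1-3)])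
    have d: "4096 \<le> d" "d < n" using elim(2) by (auto simp: d_def)
    have "\<mu> L = (1 - 2 * a) ^ (L - 1) / 2" using scale(3) by (simp add: \<mu>_def)
    then have "(1 - \<mu> L) ^ d \<le> 1 / 32" using geometric_top_rare[OF scale(1,2) d(1) scale(4)] by (simp only:)
    then show ?case
      using expected_excess_weight_ge[OF _ _ d(2) \<epsilon> a_def, of \<delta>] scale(5) elim(1) d(1)
      by (meson le_trans less_imp_le one_le_numeral order_trans)
  qed
qed simp

end
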